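(* Let $\alpha \in (-\pi/2, \pi/2)$ and $k \in [\,|\tan(\alpha/2)|, 1)$. For $f \in \mathcal{A}$, if $$e^{i\alpha} \frac{z f'(z)}{f(z)} \in U(k)$$ for all $z \in \mathbb{D}$, then $f$ has a $k$-quasiconformal extension to $\mathbb{C}$.
   Context: $\mathbb{D} = \{z \in \mathbb{C} : |z| < 1\}$. $\mathcal{A}$ denotes the class of functions $f$ analytic on $\mathbb{D}$ with $f(0) = 0$ and $f'(0) = 1$. The quotient $zf'(z)/f(z)$ is understood to take the value $1$ at $z=0$ (removable singularity). For $0 \leq k < 1$, $$U(k) = \left\{ w \in \mathbb{C} : \left| \frac{w-1}{w+1} \right| \leq k \right\} = \left\{ w \in \mathbb{C} : \left| w - \frac{1+k^2}{1-k^2} \right| \leq \frac{2k}{1-k^2} \right\}.$$ A sense-preserving homeomorphism $F$ of a domain $G \subset \mathbb{C}$ is called $k$-quasiconformal, $k \in [0,1)$, if $F_z$ and $F_{\bar z}$, the partial derivatives in $z$ and $\bar z$ in the distributional sense, are locally integrable on $G$ and satisfy $|F_{\bar z}| \leq k |F_z|$ almost everywhere in $G$. A $k$-quasiconformal extension of $f$ to $\mathbb{C}$ is a $k$-quasiconformal homeomorphism of $\mathbb{C}$ onto itself which coincides with $f$ on $\mathbb{D}$. *)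

theory Defs
  imports "HOL-Complex_Analysis.Complex_Analysis"
begin

definition class_A :: "(complex \<Rightarrow> complex) set" where
  "class_A = {f. f holomorphic_on ball 0 1 \<and> f 0 = 0 \<and> deriv f 0 = 1}"

(* The singularity at 0 is removed explicitly. At any other zero of f the totalised
   quotient is 0, which is not an element of any U_set k with k < 1. *)
definition starlike_quotient :: "(complex \<Rightarrow> complex) \<Rightarrow> complex \<Rightarrow> complex" where
  "starlike_quotient f z = (if z = 0 then 1 else z * deriv f z / f z)"

(* The point -1 must be excluded by hand, because the totalised division makes the
   quotient 0 there. *)
definition U_set :: "real \<Rightarrow> complex set" where
  "U_set k = {w. w \<noteq> - 1 \<and> cmod ((w - 1) / (w + 1)) \<le> k}"

definition partial_x :: "(complex \<Rightarrow> complex) \<Rightarrow> complex \<Rightarrow> complex" where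
  "partial_x \<phi> z = frechet_derivative \<phi> (at z) 1"

definition partial_y :: "(complex \<Rightarrow> complex) \<Rightarrow> complex \<Rightarrow> complex" where
  "partial_y \<phi> z = frechet_derivative \<phi> (at z) \<i>"

definition wirtinger_z :: "(complex \<Rightarrow> complex) \<Rightarrow> complex \<Rightarrow> complex" where
  "wirtinger_z \<phi> z = (partial_x \<phi> z - \<i> * partial_y \<phi> z) / 2"

definition wirtinger_zbar :: "(complex \<Rightarrow> complex) \<Rightarrow> complex \<Rightarrow> complex" where
  "wirtinger_zbar \<phi> z = (partial_x \<phi> z + \<i> * partial_y \<phi> z) / 2"

(* Differentiability in the real sense, on the whole plane. *)
primrec C_times :: "nat \<Rightarrow> (complex \<Rightarrow> complex) \<Rightarrow> bool" where
  "C_times 0 \<phi> \<longleftrightarrow> continuous_on UNIV \<phi>"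
| "C_times (Suc n) \<phi> \<longleftrightarrow>
     (\<forall>z. \<phi> differentiable (at z)) \<and> C_times n (partial_x \<phi>) \<and> C_times n (partial_y \<phi>)"

definition test_function :: "complex set \<Rightarrow> (complex \<Rightarrow> complex) \<Rightarrow> bool" where
  "test_function G \<phi> \<longleftrightarrow>
     (\<forall>n. C_times n \<phi>) \<and>
     compact (closure {z. \<phi> z \<noteq> 0}) \<and> closure {z. \<phi> z \<noteq> 0} \<subseteq> G"

definition locally_integrable_on :: "(complex \<Rightarrow> complex) \<Rightarrow> complex set \<Rightarrow> bool" where
  "locally_integrable_on g G \<longleftrightarrow>
     (\<forall>K. compact K \<and> K \<subseteq> G \<longrightarrow> g absolutely_integrable_on K)"

(* "g is a distributional derivative of F on G", for locally integrable g; the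
   integrals are with respect to two-dimensional Lebesgue measure. *)
definition has_dist_deriv_z ::
    "(complex \<Rightarrow> complex) \<Rightarrow> (complex \<Rightarrow> complex) \<Rightarrow> complex set \<Rightarrow> bool" where
  "has_dist_deriv_z F g G \<longleftrightarrow>
     locally_integrable_on F G \<and> locally_integrable_on g G \<and>
     (\<forall>\<phi>. test_function G \<phi> \<longrightarrow>
        (LINT z:G|lebesgue. F z * wirtinger_z \<phi> z) = - (LINT z:G|lebesgue. g z * \<phi> z))"

definition has_dist_deriv_zbar ::
    "(complex \<Rightarrow> complex) \<Rightarrow> (complex \<Rightarrow> complex) \<Rightarrow> complex set \<Rightarrow> bool" where
  "has_dist_deriv_zbar F g G \<longleftrightarrow>
     locally_integrable_on F G \<and> locally_integrable_on g G \<and>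
     (\<forall>\<phi>. test_function G \<phi> \<longrightarrow>
        (LINT z:G|lebesgue. F z * wirtinger_zbar \<phi> z) = - (LINT z:G|lebesgue. g z * \<phi> z))"

(* Local degree 1 at every point. The winding number is the one of an arbitrary continuous
   closed curve, so F need not be differentiable; for injective F the curve avoids F z. *)
definition sense_preserving_on :: "complex set \<Rightarrow> (complex \<Rightarrow> complex) \<Rightarrow> bool" where
  "sense_preserving_on G F \<longleftrightarrow>
     (\<forall>z r. 0 < r \<and> cball z r \<subseteq> G \<longrightarrow> winding_number (F \<circ> circlepath z r) (F z) = 1)"

(* Distributional derivatives are unique up to null sets, so the inequality does not depend
   on the choice of the representatives Fz and Fzbar. *)
definition quasiconformal_on :: "real \<Rightarrow> complex set \<Rightarrow> (complex \<Rightarrow> complex) \<Rightarrow> bool" where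
  "quasiconformal_on k G F \<longleftrightarrow>
     0 \<le> k \<and> k < 1 \<and> open G \<and> connected G \<and> G \<noteq> {} \<and>
     (\<exists>H. homeomorphism G (F ` G) F H) \<and>
     sense_preserving_on G F \<and>
     (\<exists>Fz Fzbar. has_dist_deriv_z F Fz G \<and> has_dist_deriv_zbar F Fzbar G \<and>
        (AE z in lebesgue. z \<in> G \<longrightarrow> cmod (Fzbar z) \<le> k * cmod (Fz z)))"

definition has_quasiconformal_extension :: "real \<Rightarrow> (complex \<Rightarrow> complex) \<Rightarrow> bool" where
  "has_quasiconformal_extension k f \<longleftrightarrow>
     (\<exists>F. quasiconformal_on k UNIV F \<and> F ` UNIV = UNIV \<and> (\<forall>z\<in>ball 0 1. F z = f z))"

end

theory Submission imports Defs begin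

text \<open>
Put \<open>c = e\<^sup>-\<^sup>i\<^sup>\<alpha>\<close> and write \<open>f z = z * exp (g z)\<close> on the unit disc, so that
\<open>z f' z / f z = 1 + z g' z\<close>. In the logarithmic coordinate \<open>\<zeta> = log z\<close> the map
\<open>M \<zeta> = (\<zeta> + g (exp \<zeta>)) / c\<close> of the open left half-plane satisfies \<open>exp (c * M \<zeta>) = f (exp \<zeta>)\<close>,
and the hypothesis says that \<open>M'\<close> takes values in \<open>U(k)\<close>. Now \<open>U(k)\<close> is a Euclidean disc with
centre \<open>w\<close> and radius \<open>R < w\<close>; integrating \<open>M' - w\<close> along segments gives the one inequality on which
everything rests,
\<open>\<bar>M x - M y - w * (x - y)\<bar> \<le> R * \<bar>x - y\<bar>\<close>.

It makes \<open>M\<close> Lipschitz, so that \<open>M\<close> extends to the imaginary axis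
(\<open>half_plane_boundary_extension\<close>). On the right half-plane put \<open>M (s + i \<theta>) = s + M (i \<theta>)\<close>, which
after exponentiation reads \<open>F (r e\<^sup>i\<^sup>\<theta>) = r\<^sup>c f (e\<^sup>i\<^sup>\<theta>)\<close>: this is Becker's extension along the
Loewner chain \<open>exp (c * t) * f\<close>. The inequality also says that \<open>M\<close> is strongly monotone,
which is why the glued map is injective (\<open>inj_shift_extension\<close>); it carries the
translation by \<open>2 \<pi> i\<close> to that by \<open>2 \<pi> i / c\<close>, so it descends to an injective map
\<open>F\<close> of the plane (\<open>inj_exp_conjugate\<close>). Since \<open>Re c > 0\<close>, \<open>F\<close> is proper, and invariance of
domain turns it into a homeomorphism of the plane onto itself; its local degree is 1 because the circle
\<open>(z, r)\<close> can be moved to a small circle about 0 without \<open>F\<close> taking the value of the centre on it.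

For the dilatation, the boundary function \<open>\<theta> \<mapsto> M (i \<theta>)\<close> is Lipschitz, hence differentiable almost
everywhere, with derivative \<open>i Q\<close> and, by the same inequality, \<open>Q \<in> U(k)\<close>. At such \<open>\<theta>\<close> the glued
map has the derivative \<open>h \<mapsto> Re h + i Q Im h\<close>, whose Beltrami coefficient \<open>(1 - Q) / (1 + Q)\<close>
has modulus at most \<open>k\<close>. Finally \<open>F\<close> is locally Lipschitz, and for a
locally Lipschitz map that is differentiable almost everywhere the pointwise derivatives are the
distributional ones (\<open>has_dist_deriv_pointwise\<close>): move the difference quotient from the test function to
the map and use dominated convergence.
\<close>

section \<open>Lipschitz functions of one real variable are differentiable almost everywhere\<close>

text \<open>
The heart of Lebesgue's differentiation theorem. On \<open>A\<close> the measure \<open>\<mu>\<close> is at most \<open>p * \<nu>\<close>, yet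
arbitrarily short intervals around the points of \<open>E\<close> give it at least \<open>q * \<nu>\<close>. Vitali's theorem
selects disjoint such intervals \<open>W\<close> inside an open set which exceeds \<open>A\<close> by little in \<open>\<mu>\<close>-measure, and
then \<open>q * \<nu> W \<le> \<mu> W \<le> p * \<nu> W + \<epsilon>\<close> forces \<open>\<nu> W\<close>, hence the length of \<open>W\<close>, to be small.
Either of the two measures compared below can play the part of \<open>\<mu>\<close>: one choice bounds difference
quotients from above, the other from below.
\<close>

lemma null_of_fine_interval_cover:
  fixes \<mu> \<nu> :: "real measure" and A E :: "real set" and p q :: real
  assumes sets [measurable_cong]: "sets \<mu> = sets borel" "sets \<nu> = sets borel"
    and fin: "\<And>a b. emeasure \<mu> {a..b} < \<infinity>" "\<And>a b. emeasure \<nu> {a..b} < \<infinity>"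
    and leb: "\<And>a b. emeasure lborel {a..b} \<le> emeasure \<nu> {a..b}"
    and pq: "0 \<le> p" "p < q"
    and A: "A \<in> sets borel"
    and small: "\<And>B. B \<in> sets borel \<Longrightarrow> B \<subseteq> A \<Longrightarrow> emeasure \<mu> B \<le> ennreal p * emeasure \<nu> B"
    and E: "E \<subseteq> A" "E \<subseteq> {-m<..<m}"
    and cover: "\<And>x d. x \<in> E \<Longrightarrow> 0 < d \<Longrightarrow>
       \<exists>a b. a < b \<and> b - a < d \<and> x \<in> {a..b} \<and> ennreal q * emeasure \<nu> {a..b} \<le> emeasure \<mu> {a..b}"
  shows "negligible E"
  unfolding negligible_outer_le
proof (intro allI impI)
  fix e :: real assume e: "0 < e"
  define J where "J = {-m<..<m}"
  \<comment> \<open>Outer regularity is available for finite measures only, hence the restriction to a bounded interval.\<close>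
  define \<mu>' where "\<mu>' = density \<mu> (indicator J)"
  have Jm: "J \<in> sets borel" by (simp add: J_def)
  have em': "emeasure \<mu>' B = emeasure \<mu> (B \<inter> J)" if "B \<in> sets borel" for B
    using that sets Jm unfolding \<mu>'_def
    by (subst emeasure_density)
       (auto intro!: nn_integral_cong simp: nn_integral_indicator[symmetric] indicator_def simp del: nn_integral_indicator)
  have muJ: "emeasure \<mu> (B \<inter> J) < \<infinity>" if "B \<in> sets borel" for B
  proof -
    have "emeasure \<mu> (B \<inter> J) \<le> emeasure \<mu> {-m..m}"
      by (rule emeasure_mono) (auto simp: J_def sets)
    with fin show ?thesis by (meson le_less_trans)
  qed
  have sets': "sets \<mu>' = sets borel" by (simp add: \<mu>'_def sets)
  have fin': "emeasure \<mu>' (space \<mu>') \<noteq> \<infinity>"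
    using muJ[of UNIV] sets_eq_imp_space_eq[OF sets'] by (simp add: em')
  \<comment> \<open>Chosen so that (q - p) t <= epsilon yields t <= e.\<close>
  define \<epsilon> where "\<epsilon> = e * (q - p)"
  have \<epsilon>: "\<epsilon> > 0" using e pq by (simp add: \<epsilon>_def)
  have "emeasure \<mu>' A = (INF U \<in> {U. A \<subseteq> U \<and> open U}. emeasure \<mu>' U)"
    by (rule outer_regular[OF sets' fin' A])
  moreover have "emeasure \<mu>' A < emeasure \<mu>' A + ennreal \<epsilon>"
    using muJ[OF A] em'[OF A] \<epsilon> by (cases "emeasure \<mu> (A \<inter> J)") (auto simp: ennreal_less_iff simp flip: ennreal_plus)
  ultimately have "(INF U \<in> {U. A \<subseteq> U \<and> open U}. emeasure \<mu>' U) < emeasure \<mu>' A + ennreal \<epsilon>"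
    by simp
  then obtain U where U: "A \<subseteq> U" "open U" "emeasure \<mu>' U < emeasure \<mu>' A + ennreal \<epsilon>"
    unfolding INF_less_iff by auto
  have Um: "U \<in> sets borel" using U by simp
  have diff: "emeasure \<mu> ((U - A) \<inter> J) \<le> ennreal \<epsilon>"
  proof -
    have "emeasure \<mu>' U = emeasure \<mu>' A + emeasure \<mu>' (U - A)"
      using U A sets' by (subst plus_emeasure) (auto intro!: arg_cong[where f="emeasure \<mu>'"])
    then have "emeasure \<mu>' A + emeasure \<mu>' (U - A) \<le> emeasure \<mu>' A + ennreal \<epsilon>"
      using U(3) by (metis less_imp_le)
    then have "emeasure \<mu>' (U - A) \<le> ennreal \<epsilon>"
      using muJ[OF A] em'[OF A] ennreal_add_left_cancel_le[of "emeasure \<mu>' A"] by auto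
    then show ?thesis using em'[of "U-A"] Um A by auto
  qed
  define K where "K = {(a,b). a < b \<and> {a..b} \<subseteq> U \<inter> J \<and> ennreal q * emeasure \<nu> {a..b} \<le> emeasure \<mu> {a..b}}"
  define ce ra where "ce = (\<lambda>(a,b). (a+b)/2 :: real)" and "ra = (\<lambda>(a,b). (b-a)/2 :: real)"
  have cb: "cball (ce i) (ra i) = {fst i..snd i}" for i
    by (cases i) (simp add: ce_def ra_def cball_eq_atLeastAtMost field_simps)
  have "\<exists>i. i \<in> K \<and> x \<in> cball (ce i) (ra i) \<and> ra i < d" if x: "x \<in> E" and d: "0 < d" for x d
  proof -
    have "x \<in> U \<inter> J" "open (U \<inter> J)" using x E U by (auto simp: J_def)
    then obtain \<delta> where \<delta>: "\<delta> > 0" "ball x \<delta> \<subseteq> U \<inter> J" by (meson openE)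
    obtain a b where ab: "a < b" "b - a < min d \<delta>" "x \<in> {a..b}" "ennreal q * emeasure \<nu> {a..b} \<le> emeasure \<mu> {a..b}"
      using cover[OF x, of "min d \<delta>"] d \<delta> by auto
    have "{a..b} \<subseteq> ball x \<delta>" using ab by (auto simp: dist_real_def)
    then have "(a,b) \<in> K" using \<delta> ab by (auto simp: K_def)
    moreover have "ra (a,b) < d" using ab by (simp add: ra_def)
    ultimately show ?thesis using ab(3) cb[of "(a,b)"] by (intro exI[of _ "(a,b)"]) auto
  qed
  note vitali = this
  have ra_pos: "\<And>i. i \<in> K \<Longrightarrow> 0 < ra i" by (auto simp: K_def ra_def)
  obtain C where C: "countable C" "C \<subseteq> K"
     "pairwise (\<lambda>i j. disjnt (cball (ce i) (ra i)) (cball (ce j) (ra j))) C"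
     "negligible (E - (\<Union>i \<in> C. cball (ce i) (ra i)))"
    by (rule Vitali_covering_theorem_cballs[of K ra E ce, OF ra_pos vitali]) blast
  define X where "X = (\<lambda>i::real\<times>real. {fst i..snd i})"
  define W where "W = (\<Union>i\<in>C. X i)"
  have Xm: "X i \<in> sets borel" for i by (simp add: X_def)
  have Wm: "W \<in> sets borel" unfolding W_def using C(1) Xm by (intro sets.countable_UN') auto
  have disj: "disjoint_family_on X C"
    using C(3) by (auto simp: disjoint_family_on_def pairwise_def disjnt_def cb X_def)
  have WU: "W \<subseteq> U \<inter> J" using C(2) unfolding W_def X_def K_def by fastforce
  have sumM: "emeasure M W = (\<integral>\<^sup>+i. emeasure M (X i) \<partial>count_space C)" if "sets M = sets borel" for M
    unfolding W_def using that Xm C(1) disj by (intro emeasure_UN_countable) auto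
  have "ennreal q * emeasure \<nu> W = (\<integral>\<^sup>+i. ennreal q * emeasure \<nu> (X i) \<partial>count_space C)"
    by (simp add: sumM sets nn_integral_cmult)
  also have "\<dots> \<le> (\<integral>\<^sup>+i. emeasure \<mu> (X i) \<partial>count_space C)"
    using C(2) by (intro nn_integral_mono) (auto simp: K_def X_def)
  also have "\<dots> = emeasure \<mu> W" by (simp add: sumM sets)
  also have "\<dots> = emeasure \<mu> (W \<inter> A) + emeasure \<mu> (W - A)"
    using Wm A sets by (subst plus_emeasure) (auto intro!: arg_cong[where f="emeasure \<mu>"])
  also have "\<dots> \<le> ennreal p * emeasure \<nu> W + ennreal \<epsilon>"
  proof (rule add_mono)
    have "emeasure \<mu> (W \<inter> A) \<le> ennreal p * emeasure \<nu> (W \<inter> A)"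
      using Wm A by (intro small) auto
    also have "\<dots> \<le> ennreal p * emeasure \<nu> W"
      using Wm by (intro mult_left_mono emeasure_mono) (auto simp: sets)
    finally show "emeasure \<mu> (W \<inter> A) \<le> ennreal p * emeasure \<nu> W" .
    have "emeasure \<mu> (W - A) \<le> emeasure \<mu> ((U - A) \<inter> J)"
      using WU Um A Jm by (intro emeasure_mono) (auto simp: sets)
    with diff show "emeasure \<mu> (W - A) \<le> ennreal \<epsilon>" by simp
  qed
  finally have le: "ennreal q * emeasure \<nu> W \<le> ennreal p * emeasure \<nu> W + ennreal \<epsilon>" .
  have "emeasure \<nu> W \<le> emeasure \<nu> {-m..m}"
    using WU by (intro emeasure_mono) (auto simp: sets J_def)
  then have "emeasure \<nu> W < \<infinity>" using fin(2) by (meson le_less_trans)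
  then obtain t where t: "emeasure \<nu> W = ennreal t" "t \<ge> 0"
    by (metis ennreal_cases infinity_ennreal_def less_irrefl)
  have "q * t \<le> p * t + \<epsilon>"
    using le t pq \<epsilon> by (simp flip: ennreal_mult ennreal_plus)
  then have "(q - p) * t \<le> (q - p) * e" by (simp add: \<epsilon>_def algebra_simps)
  then have te: "t \<le> e" using pq by simp
  have "emeasure lborel W = (\<integral>\<^sup>+i. emeasure lborel (X i) \<partial>count_space C)" by (simp add: sumM)
  also have "\<dots> \<le> (\<integral>\<^sup>+i. emeasure \<nu> (X i) \<partial>count_space C)"
    unfolding X_def by (intro nn_integral_mono leb)
  also have "\<dots> = emeasure \<nu> W" by (simp add: sumM sets)
  also have "\<dots> \<le> ennreal e" using t te by (simp add: ennreal_leI)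
  finally have lW: "emeasure lebesgue W \<le> ennreal e" using Wm by simp
  then have Wl: "W \<in> lmeasurable" using Wm by (intro fmeasurableI) (auto intro: le_less_trans)
  have mW: "measure lebesgue W \<le> e"
    unfolding measure_def using lW e by (intro enn2real_leI) auto
  have N: "negligible (E - W)" using C(4) by (simp add: W_def X_def cb)
  have NlM: "E - W \<in> lmeasurable" using N by (simp add: negligible_imp_measurable)
  show "\<exists>T. E \<subseteq> T \<and> T \<in> lmeasurable \<and> measure lebesgue T \<le> e"
  proof (intro exI conjI)
    show "E \<subseteq> W \<union> (E - W)" by auto
    show "W \<union> (E - W) \<in> lmeasurable" using Wl NlM by (rule fmeasurable.Un)
    have "measure lebesgue (W \<union> (E - W)) \<le> measure lebesgue W + measure lebesgue (E - W)"
      using Wl NlM by (intro measure_Un_le) (auto)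
    then show "measure lebesgue (W \<union> (E - W)) \<le> e" using mW N by (simp add: negligible_imp_measure0)
  qed
qed

text \<open>
The image measure \<open>\<mu> {a..b} = v b - v a\<close> has a density \<open>h\<close> by Radon-Nikodym, the Lipschitz bound giving
absolute continuity; the derivative of \<open>v\<close> is \<open>h\<close> almost everywhere. The expansion bound makes \<open>v\<close>
invertible, so that \<open>\<mu>\<close> is simply the image of Lebesgue measure under the inverse, and it makes
\<open>\<mu>\<close> dominate Lebesgue measure.
\<close>

lemma expanding_lipschitz_ae_differentiable:
  fixes v :: "real \<Rightarrow> real"
  assumes lo: "\<And>x y. x \<le> y \<Longrightarrow> y - x \<le> v y - v x"
    and hi: "\<And>x y. x \<le> y \<Longrightarrow> v y - v x \<le> C * (y - x)"
  shows "negligible {x. \<not> v differentiable (at x)}"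
proof -
  have C: "C \<ge> 1" using lo[of 0 1] hi[of 0 1] by simp
  have strict: "v x < v y" if "x < y" for x y using lo[of x y] that by simp
  have inj: "v x = v y \<longleftrightarrow> x = y" for x y using strict[of x y] strict[of y x] by (cases x y rule: linorder_cases) auto
  have le_iff: "v x \<le> v y \<longleftrightarrow> x \<le> y" for x y using strict[of x y] strict[of y x] by (cases x y rule: linorder_cases) auto
  have lip: "\<bar>v y - v x\<bar> \<le> C * \<bar>y - x\<bar>" for x y
    using hi[of x y] hi[of y x] lo[of x y] lo[of y x] by (cases "x \<le> y") auto
  have "C-lipschitz_on UNIV v"
    using C lip by (intro lipschitz_onI) (auto simp: dist_real_def)
  then have cont: "continuous_on UNIV v" by (rule lipschitz_on_continuous_on)
  have ex: "\<exists>x. v x = y" for y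
  proof -
    define b where "b = \<bar>y\<bar> + \<bar>v 0\<bar>"
    have "b \<ge> 0" by (simp add: b_def)
    moreover have "v (-b) \<le> y" "y \<le> v b"
      using lo[of "-b" 0] lo[of 0 b] \<open>b \<ge> 0\<close> by (auto simp: b_def abs_if split: if_splits)
    ultimately have "\<exists>x\<ge>-b. x \<le> b \<and> v x = y"
      by (intro IVT') (auto intro: continuous_on_subset[OF cont])
    then show ?thesis by auto
  qed
  define w where "w = inv v"
  have vw: "v (w y) = y" for y unfolding w_def using ex by (metis surj_def surj_f_inv_f)
  have wv: "w (v x) = x" for x using vw inj by blast
  have "mono w" by (rule monoI) (metis vw le_iff)
  then have wm: "w \<in> borel_measurable borel" by (rule borel_measurable_mono)
  define \<mu> where "\<mu> = distr lborel borel w"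
  have sets\<mu>: "sets \<mu> = sets borel" by (simp add: \<mu>_def)
  have em: "emeasure \<mu> B = emeasure lborel (w -` B)" if "B \<in> sets borel" for B
    using that wm by (simp add: \<mu>_def emeasure_distr)
  have vimage: "w -` {a..b} = {v a..v b}" for a b
    by auto (metis vw le_iff)+
  have emI: "emeasure \<mu> {a..b} = ennreal (if a \<le> b then v b - v a else 0)" for a b
    by (simp add: em vimage emeasure_lborel_Icc_eq le_iff)
  have ac: "absolutely_continuous lborel \<mu>"
    unfolding absolutely_continuous_def
  proof
    fix B assume B: "B \<in> null_sets (lborel :: real measure)"
    then have Bm: "B \<in> sets borel" by auto
    have "negligible B" using B by (simp add: negligible_iff_null_sets null_sets_completionI)
    then have "negligible (v ` B)"
      by (rule negligible_locally_Lipschitz_image[OF order_refl]) (use lip in \<open>force intro: exI[of _ UNIV] exI[of _ C]\<close>)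
    moreover have "v ` B = w -` B" using vw wv by (auto simp: image_iff) (metis vw)
    ultimately have "negligible (w -` B)" by simp
    moreover have "w -` B \<in> sets borel" using measurable_sets[OF wm Bm] by simp
    ultimately have "emeasure lborel (w -` B) = 0"
      by (simp add: negligible_iff_emeasure0)
    then show "B \<in> null_sets \<mu>" using Bm by (auto simp: null_sets_def em sets\<mu>)
  qed
  obtain h where hm [measurable]: "h \<in> borel_measurable borel" and h: "density lborel h = \<mu>"
    using sigma_finite_measure.Radon_Nikodym[OF sigma_finite_lborel ac] sets\<mu> by auto
  have emh: "emeasure \<mu> B = (\<integral>\<^sup>+x. h x * indicator B x \<partial>lborel)" if "B \<in> sets borel" for B
    using that by (simp add: h[symmetric] emeasure_density)
  define sl where "sl = (\<lambda>x y. (v y - v x) / (y - x))"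
  have seg: "\<exists>a b. a < b \<and> b - a < d \<and> x \<in> {a..b} \<and> v b - v a = sl x y * (b - a)"
    if "y \<noteq> x" "\<bar>y - x\<bar> < d" for x y d
    using that by (intro exI[of _ "min x y"] exI[of _ "max x y"]) (auto simp: sl_def min_def max_def field_simps)
  \<comment> \<open>E1 and E2 collect the points where some limit of difference quotients lies above, respectively below, the density.\<close>
  define E1 where "E1 = (\<lambda>p q (m::nat). {x\<in>{-real m<..<real m}. h x \<le> ennreal p \<and> (\<forall>d>0. \<exists>y. y \<noteq> x \<and> \<bar>y - x\<bar> < d \<and> q < sl x y)})"
  define E2 where "E2 = (\<lambda>p q (m::nat). {x\<in>{-real m<..<real m}. h x \<ge> ennreal q \<and> (\<forall>d>0. \<exists>y. y \<noteq> x \<and> \<bar>y - x\<bar> < d \<and> sl x y < p)})"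
  have N1: "negligible (E1 p q m)" if pq: "0 < p" "p < q" for p q m
  proof (rule null_of_fine_interval_cover[of \<mu> lborel p q "{x. h x \<le> ennreal p}" _ m])
    fix B :: "real set" assume B: "B \<in> sets borel" "B \<subseteq> {x. h x \<le> ennreal p}"
    have "emeasure \<mu> B \<le> (\<integral>\<^sup>+x. ennreal p * indicator B x \<partial>lborel)"
      unfolding emh[OF B(1)] using B(2) by (intro nn_integral_mono) (auto simp: indicator_def)
    also have "\<dots> = ennreal p * emeasure lborel B" using B(1) by (simp add: nn_integral_cmult_indicator)
    finally show "emeasure \<mu> B \<le> ennreal p * emeasure lborel B" .
  next
    fix x d :: real assume x: "x \<in> E1 p q m" and d: "0 < d"
    then obtain y where y: "y \<noteq> x" "\<bar>y - x\<bar> < d" "q < sl x y" by (auto simp: E1_def)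
    then obtain a b where ab: "a < b" "b - a < d" "x \<in> {a..b}" "v b - v a = sl x y * (b - a)" using seg by metis
    have "q * (b - a) \<le> v b - v a" unfolding ab(4) using y ab by (intro mult_right_mono) auto
    then have "ennreal q * emeasure lborel {a..b} \<le> emeasure \<mu> {a..b}"
      using ab(1) pq by (simp add: emI ennreal_leI flip: ennreal_mult)
    with ab show "\<exists>a b. a < b \<and> b - a < d \<and> x \<in> {a..b} \<and> ennreal q * emeasure lborel {a..b} \<le> emeasure \<mu> {a..b}" by blast
  qed (use pq in \<open>auto simp: sets\<mu> emI E1_def emeasure_lborel_Icc_eq\<close>)
  have N2: "negligible (E2 p q m)" if pq: "0 < p" "p < q" for p q m
  proof (rule null_of_fine_interval_cover[of lborel \<mu> "1/q" "1/p" "{x. h x \<ge> ennreal q}" _ m])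
    fix B :: "real set" assume B: "B \<in> sets borel" "B \<subseteq> {x. h x \<ge> ennreal q}"
    have "ennreal q * emeasure lborel B = (\<integral>\<^sup>+x. ennreal q * indicator B x \<partial>lborel)"
      using B(1) by (simp add: nn_integral_cmult_indicator)
    also have "\<dots> \<le> emeasure \<mu> B"
      unfolding emh[OF B(1)] using B(2) by (intro nn_integral_mono) (auto simp: indicator_def)
    finally have "ennreal (1/q) * (ennreal q * emeasure lborel B) \<le> ennreal (1/q) * emeasure \<mu> B"
      by (intro mult_left_mono) auto
    moreover have "ennreal (1/q) * (ennreal q * emeasure lborel B) = emeasure lborel B"
      using pq by (simp add: mult.assoc[symmetric] flip: ennreal_mult)
    ultimately show "emeasure lborel B \<le> ennreal (1/q) * emeasure \<mu> B" by simp
  next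
    fix x d :: real assume x: "x \<in> E2 p q m" and d: "0 < d"
    then obtain y where y: "y \<noteq> x" "\<bar>y - x\<bar> < d" "sl x y < p" by (auto simp: E2_def)
    then obtain a b where ab: "a < b" "b - a < d" "x \<in> {a..b}" "v b - v a = sl x y * (b - a)" using seg by metis
    have "v b - v a \<le> p * (b - a)" unfolding ab(4) using y ab by (intro mult_right_mono) auto
    then have "(1/p) * (v b - v a) \<le> b - a" using pq by (simp add: field_simps)
    then have "ennreal (1/p) * emeasure \<mu> {a..b} \<le> emeasure lborel {a..b}"
      using ab(1) pq strict[OF ab(1)] by (simp add: emI flip: ennreal_mult)
    with ab show "\<exists>a b. a < b \<and> b - a < d \<and> x \<in> {a..b} \<and> ennreal (1/p) * emeasure \<mu> {a..b} \<le> emeasure lborel {a..b}" by blast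
  next
    show "emeasure lborel {a..b} \<le> emeasure \<mu> {a..b}" for a b
      using lo[of a b] by (auto simp: emI emeasure_lborel_Icc_eq intro!: ennreal_leI)
  qed (use pq in \<open>auto simp: sets\<mu> emI E2_def emeasure_lborel_Icc_eq field_simps\<close>)
  define S where "S = (\<Union>p\<in>{p\<in>\<rat>. 0 < p}. \<Union>q\<in>{q\<in>\<rat>. p < q}. \<Union>m. E1 p q m \<union> E2 p q m)"
  have "negligible S"
    unfolding S_def
  proof (intro negligible_countable_Union)
    fix X assume "X \<in> (\<lambda>p. \<Union>q\<in>{q\<in>\<rat>. p < q}. \<Union>m. E1 p q m \<union> E2 p q m) ` {p\<in>\<rat>. 0 < p}"
    then obtain p where p: "0 < p" "X = (\<Union>q\<in>{q\<in>\<rat>. p < q}. \<Union>m. E1 p q m \<union> E2 p q m)" by auto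
    show "negligible X" unfolding p(2)
    proof (intro negligible_countable_Union)
      fix Y assume "Y \<in> (\<lambda>q. \<Union>m. E1 p q m \<union> E2 p q m) ` {q\<in>\<rat>. p < q}"
      then obtain q where q: "p < q" "Y = (\<Union>m. E1 p q m \<union> E2 p q m)" by auto
      show "negligible Y" unfolding q(2)
        using N1 N2 p q by (intro negligible_countable_Union) auto
    qed (auto intro: countable_subset[OF _ countable_rat])
  qed (auto intro: countable_subset[OF _ countable_rat])
  moreover have "v differentiable (at x)" if x: "x \<notin> S" for x
  proof -
    obtain m :: nat where m: "\<bar>x\<bar> < real m" using reals_Archimedean2 by blast
    then have xm: "x \<in> {-real m<..<real m}" by auto
    have nE: "x \<notin> E1 p q m" "x \<notin> E2 p q m" if "p \<in> \<rat>" "q \<in> \<rat>" "0 < p" "p < q" for p q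
      using x that unfolding S_def by blast+
    \<comment> \<open>Difference quotients never exceed C, so a point with h x > C would lie in some E2.\<close>
    have "h x \<noteq> top"
    proof
      assume top: "h x = top"
      obtain p where p: "p \<in> \<rat>" "C < p" using Rats_dense_in_real[of C "C+1"] by auto
      obtain q where q: "q \<in> \<rat>" "p < q" using Rats_dense_in_real[of p "p+1"] by auto
      have "\<exists>y. y \<noteq> x \<and> \<bar>y - x\<bar> < d \<and> sl x y < p" if "d > 0" for d
      proof (intro exI[of _ "x + d/2"] conjI)
        have "sl x (x + d/2) \<le> C" using hi[of x "x+d/2"] that by (simp add: sl_def field_simps)
        then show "sl x (x + d/2) < p" using p by simp
      qed (use that in auto)
      then have "x \<in> E2 p q m" using xm top by (simp add: E2_def)
      then show False using nE(2)[of p q] p q C by simp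
    qed
    then obtain L where L: "h x = ennreal L" "L \<ge> 0" by (metis ennreal_cases)
    have "(sl x \<longlongrightarrow> L) (at x)"
    proof (rule order_tendstoI)
      fix a assume a: "a < L"
      show "eventually (\<lambda>y. a < sl x y) (at x)"
      \<comment> \<open>E2 is known to be null for positive p only; below 1 the expansion bound takes over.\<close>
      proof (cases "a < 1")
        case True
        have "1 \<le> sl x y" if "y \<noteq> x" for y
          using lo[of x y] lo[of y x] that by (cases "x \<le> y") (auto simp: sl_def field_simps)
        then show ?thesis using True by (auto simp: eventually_at intro!: exI[of _ 1]) (meson less_le_trans)
      next
        case False
        obtain p where p: "p \<in> \<rat>" "a < p" "p < L" using Rats_dense_in_real[OF a] by auto
        obtain q where q: "q \<in> \<rat>" "p < q" "q < L" using Rats_dense_in_real[OF p(3)] by auto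
        have "x \<notin> E2 p q m" using nE p q False by simp
        moreover have "ennreal q \<le> h x" using L q by (simp add: ennreal_leI)
        ultimately obtain d where d: "d > 0" "\<And>y. y \<noteq> x \<Longrightarrow> \<bar>y - x\<bar> < d \<Longrightarrow> p \<le> sl x y"
          using xm unfolding E2_def by (auto simp: not_less) (metis leD)
        then show ?thesis unfolding eventually_at using p(2)
          by (intro exI[of _ d]) (auto simp: dist_real_def intro: less_le_trans)
      qed
    next
      fix a assume a: "L < a"
      obtain p where p: "p \<in> \<rat>" "L < p" "p < a" using Rats_dense_in_real[OF a] by auto
      obtain q where q: "q \<in> \<rat>" "p < q" "q < a" using Rats_dense_in_real[OF p(3)] by auto
      have "x \<notin> E1 p q m" using nE p q L by simp
      moreover have "h x \<le> ennreal p" using L p by (simp add: ennreal_leI)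
      ultimately obtain d where d: "d > 0" "\<And>y. y \<noteq> x \<Longrightarrow> \<bar>y - x\<bar> < d \<Longrightarrow> sl x y \<le> q"
        using xm unfolding E1_def by (auto simp: not_less) (metis leD)
      then show "eventually (\<lambda>y. sl x y < a) (at x)" unfolding eventually_at using q(3)
        by (intro exI[of _ d]) (auto simp: dist_real_def intro: le_less_trans)
    qed
    then have "(v has_field_derivative L) (at x)"
      unfolding has_field_derivative_iff sl_def .
    then show ?thesis unfolding differentiable_def has_field_derivative_def by blast
  qed
  ultimately show ?thesis by (elim negligible_subset) auto
qed

text \<open>
Adding the linear function \<open>(L + 1) * x\<close> makes the function expanding without affecting
differentiability.
\<close>

lemma lipschitz_ae_differentiable:
  fixes u :: "real \<Rightarrow> real"
  assumes "L-lipschitz_on UNIV u"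
  shows "negligible {x. \<not> u differentiable (at x)}"
proof -
  define v where "v = (\<lambda>x. u x + (L + 1) * x)"
  have L: "\<bar>u y - u x\<bar> \<le> L * (y - x)" if "x \<le> y" for x y
    using lipschitz_onD[OF assms, of y x] that by (simp add: dist_real_def)
  have "negligible {x. \<not> v differentiable (at x)}"
  proof (rule expanding_lipschitz_ae_differentiable[of _ "2 * L + 1"])
    fix x y :: real assume xy: "x \<le> y"
    then show "y - x \<le> v y - v x" "v y - v x \<le> (2 * L + 1) * (y - x)"
      using L[OF xy] by (auto simp: v_def abs_le_iff algebra_simps)
  qed
  moreover have "u differentiable (at x)" if "v differentiable (at x)" for x
  proof -
    have "(\<lambda>x. v x - (L + 1) * x) differentiable (at x)" using that by (intro differentiable_diff) auto
    then show ?thesis by (simp add: v_def)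
  qed
  ultimately show ?thesis by (elim negligible_subset) auto
qed

lemma lipschitz_complex_ae_differentiable:
  fixes N :: "real \<Rightarrow> complex"
  assumes "L-lipschitz_on UNIV N"
  shows "negligible {x. \<not> N differentiable (at x)}"
proof -
  have "cmod (N x - N y) \<le> L * dist x y" for x y
    using lipschitz_onD[OF assms, of x y] by (simp add: dist_norm)
  then have "L-lipschitz_on UNIV (\<lambda>x. Re (N x))" "L-lipschitz_on UNIV (\<lambda>x. Im (N x))"
    using abs_Re_le_cmod[of "N _ - N _"] abs_Im_le_cmod[of "N _ - N _"] lipschitz_on_nonneg[OF assms]
    by (auto intro!: lipschitz_onI simp: dist_real_def) (meson order_trans)+
  then have "negligible ({x. \<not> (\<lambda>x. Re (N x)) differentiable (at x)} \<union> {x. \<not> (\<lambda>x. Im (N x)) differentiable (at x)})"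
    by (intro negligible_Un lipschitz_ae_differentiable)
  moreover have "N differentiable (at x)"
    if ri: "(\<lambda>x. Re (N x)) differentiable (at x)" "(\<lambda>x. Im (N x)) differentiable (at x)" for x
  proof -
    obtain R I where "((\<lambda>x. Re (N x)) has_derivative R) (at x)" "((\<lambda>x. Im (N x)) has_derivative I) (at x)"
      using ri unfolding differentiable_def by blast
    then have "((\<lambda>x. complex_of_real (Re (N x)) + \<i> * complex_of_real (Im (N x))) has_derivative (\<lambda>h. complex_of_real (R h) + \<i> * complex_of_real (I h))) (at x)"
      by (intro derivative_intros)
    then show ?thesis by (auto simp: differentiable_def simp flip: complex_eq)
  qed
  ultimately show ?thesis by (elim negligible_subset) auto
qed

section \<open>Distributional derivatives of locally Lipschitz maps\<close>

lemma has_vector_derivative_quotient_tendsto: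
  fixes f :: "real \<Rightarrow> 'a::real_normed_vector"
  assumes "(f has_vector_derivative V) (at x)"
  shows "((\<lambda>y. (f y - f x) /\<^sub>R (y - x)) \<longlongrightarrow> V) (at x)"
proof -
  have "((\<lambda>y. (f y - f x - (y - x) *\<^sub>R V) /\<^sub>R norm (y - x)) \<longlongrightarrow> 0) (at x)"
    using assms unfolding has_vector_derivative_def has_derivative_at_within by simp
  then have "((\<lambda>y. norm ((f y - f x - (y - x) *\<^sub>R V) /\<^sub>R norm (y - x))) \<longlongrightarrow> 0) (at x)"
    by (rule tendsto_norm_zero)
  moreover have "eventually (\<lambda>y. norm ((f y - f x - (y - x) *\<^sub>R V) /\<^sub>R norm (y - x)) = norm ((f y - f x) /\<^sub>R (y - x) - V)) (at x)"
  proof (rule eventually_at_filter[THEN iffD2], rule always_eventually, intro allI impI)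
    fix y assume y: "y \<noteq> x"
    then have "(f y - f x) /\<^sub>R (y - x) - V = (f y - f x - (y - x) *\<^sub>R V) /\<^sub>R (y - x)"
      by (simp add: scaleR_diff_right)
    then show "norm ((f y - f x - (y - x) *\<^sub>R V) /\<^sub>R norm (y - x)) = norm ((f y - f x) /\<^sub>R (y - x) - V)"
      by simp
  qed
  ultimately have "((\<lambda>y. norm ((f y - f x) /\<^sub>R (y - x) - V)) \<longlongrightarrow> 0) (at x)"
    by (rule Lim_transform_eventually)
  then show ?thesis by (rule LIM_zero_cancel[OF tendsto_norm_zero_cancel])
qed

text \<open>
Backward quotients: translating the integration variable turns the forward quotient of a test function
into minus the backward quotient of the map that it is paired with.
\<close>

definition diff_quotient :: "(complex \<Rightarrow> complex) \<Rightarrow> complex \<Rightarrow> nat \<Rightarrow> complex \<Rightarrow> complex" where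
  "diff_quotient F e n z = of_nat (Suc n) * (F z - F (z - e / of_nat (Suc n)))"

text \<open>
A limit of a fixed sequence of difference quotients, rather than a value of the total derivative: it is Borel
measurable on the whole plane even where the derivative does not exist.
\<close>

definition pointwise_deriv :: "(complex \<Rightarrow> complex) \<Rightarrow> complex \<Rightarrow> complex \<Rightarrow> complex" where
  "pointwise_deriv F e z = lim (\<lambda>n. diff_quotient F e n z)"

lemma directional_quotient_tendsto:
  fixes F :: "complex \<Rightarrow> complex"
  assumes "(F has_derivative D) (at z)"
  shows "(\<lambda>n. of_nat (Suc n) * (F (z + e / of_nat (Suc n)) - F z)) \<longlonglongrightarrow> D e"
proof -
  have "((\<lambda>t::real. F (z + t *\<^sub>R e)) has_derivative (\<lambda>t. D (t *\<^sub>R e))) (at 0)"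
    by (rule has_derivative_compose[of "\<lambda>t::real. z + t *\<^sub>R e" "\<lambda>t. t *\<^sub>R e" 0 UNIV F D, simplified])
       (auto intro!: derivative_eq_intros assms)
  moreover have "D (t *\<^sub>R e) = t *\<^sub>R D e" for t
    using has_derivative_bounded_linear[OF assms] by (simp add: bounded_linear.linear linear_scale)
  ultimately have "((\<lambda>t::real. F (z + t *\<^sub>R e)) has_vector_derivative D e) (at 0)"
    by (simp add: has_vector_derivative_def)
  then have lim: "((\<lambda>t::real. (F (z + t *\<^sub>R e) - F z) /\<^sub>R t) \<longlongrightarrow> D e) (at 0)"
    using has_vector_derivative_quotient_tendsto by fastforce
  have "filterlim (\<lambda>n. inverse (real (Suc n))) (at 0) sequentially"
    unfolding filterlim_at using LIMSEQ_inverse_real_of_nat by (auto intro!: always_eventually)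
  from filterlim_compose[OF lim this] show ?thesis
    by (simp add: scaleR_conv_of_real field_simps)
qed

lemma diff_quotient_tendsto:
  assumes D: "(F has_derivative D) (at z)"
  shows "(\<lambda>n. diff_quotient F e n z) \<longlonglongrightarrow> D e"
proof -
  have "(\<lambda>n. - (of_nat (Suc n) * (F (z + (- e) / of_nat (Suc n)) - F z))) \<longlonglongrightarrow> - D (- e)"
    by (intro tendsto_minus directional_quotient_tendsto[OF D])
  moreover have "- D (- e) = D e"
    using has_derivative_bounded_linear[OF D] by (simp add: bounded_linear.linear linear_neg)
  moreover have "- (of_nat (Suc n) * (F (z + (- e) / of_nat (Suc n)) - F z)) = diff_quotient F e n z" for n
    by (simp add: diff_quotient_def algebra_simps)
  ultimately show ?thesis by simp
qed

lemma pointwise_deriv_eq: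
  assumes "(F has_derivative D) (at z)"
  shows "pointwise_deriv F e z = D e"
  unfolding pointwise_deriv_def by (rule limI[OF diff_quotient_tendsto[OF assms]])

lemma borel_measurable_pointwise_deriv:
  assumes "continuous_on UNIV F"
  shows "pointwise_deriv F e \<in> borel_measurable borel"
proof -
  have "diff_quotient F e n \<in> borel_measurable borel" for n
    unfolding diff_quotient_def
    by (intro borel_measurable_continuous_onI continuous_intros
        continuous_on_compose2[OF assms]) auto
  then show ?thesis unfolding pointwise_deriv_def by (intro borel_measurable_lim_metric) auto
qed

lemma absolutely_integrable_on_compact_bounded:
  fixes g :: "complex \<Rightarrow> complex"
  assumes g: "g \<in> borel_measurable borel" and K: "compact K"
    and b: "AE z in lborel. z \<in> K \<longrightarrow> cmod (g z) \<le> B"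
  shows "g absolutely_integrable_on K"
proof -
  have Km: "K \<in> sets borel" using K by (simp add: compact_imp_closed)
  have m: "(\<lambda>z. indicator K z *\<^sub>R g z) \<in> borel_measurable lborel"
    using g Km by simp
  have "integrable lborel (\<lambda>z. indicator K z *\<^sub>R g z)"
    by (rule integrableI_bounded_set[where A = K and B = B])
       (use m Km b emeasure_compact_finite[OF K] in \<open>auto simp: indicator_def elim!: AE_mp\<close>)
  then show ?thesis
    unfolding set_integrable_def using m by (subst integrable_completion) auto
qed

lemma integrable_continuous_compact_support:
  fixes g :: "complex \<Rightarrow> complex"
  assumes c: "continuous_on UNIV g" and z: "\<And>z. z \<notin> cball 0 R \<Longrightarrow> g z = 0"
  shows "integrable lborel g"
proof -
  have "integrable lborel (\<lambda>z. indicator (cball 0 R) z *\<^sub>R g z)"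
    by (intro borel_integrable_compact continuous_on_subset[OF c]) auto
  moreover have "(\<lambda>z. indicator (cball 0 R) z *\<^sub>R g z) = g"
    using z by (auto simp: indicator_def fun_eq_iff)
  ultimately show ?thesis by simp
qed

lemma integral_translate:
  fixes g :: "complex \<Rightarrow> complex"
  assumes "continuous_on UNIV g"
  shows "(LINT z|lborel. g (z + c)) = (LINT z|lborel. g z)"
proof -
  have "(LINT z|lborel. g z) = (LINT z|distr lborel borel ((+) c). g z)"
    by (simp only: lborel_distr_plus)
  also have "\<dots> = (LINT z|lborel. g (c + z))"
    using assms by (intro integral_distr borel_measurable_continuous_onI) auto
  finally show ?thesis by (simp add: add.commute)
qed

lemma test_function_facts:
  assumes \<phi>: "test_function G \<phi>"
  shows "\<phi> differentiable (at z)" "continuous_on UNIV \<phi>"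
    and "continuous_on UNIV (partial_x \<phi>)" "continuous_on UNIV (partial_y \<phi>)"
proof -
  have "C_times 0 \<phi>" "C_times 1 \<phi>" using \<phi> unfolding test_function_def by blast+
  then show "\<phi> differentiable (at z)" "continuous_on UNIV \<phi>"
    "continuous_on UNIV (partial_x \<phi>)" "continuous_on UNIV (partial_y \<phi>)" by auto
qed

lemma test_function_support:
  assumes \<phi>: "test_function G \<phi>"
  obtains R where "R > 0" "\<And>z. z \<notin> cball 0 R \<Longrightarrow> \<phi> z = 0"
    "\<And>z e. z \<notin> cball 0 R \<Longrightarrow> frechet_derivative \<phi> (at z) e = 0"
proof -
  have "bounded (closure {z. \<phi> z \<noteq> 0})" using \<phi> unfolding test_function_def by (blast intro: compact_imp_bounded)
  then obtain R where R: "R > 0" "closure {z. \<phi> z \<noteq> 0} \<subseteq> cball 0 R"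
    by (meson bounded_subset_ballD ball_subset_cball order_trans)
  have z: "\<phi> z = 0" if "z \<notin> cball 0 R" for z
    using R(2) closure_subset[of "{z. \<phi> z \<noteq> 0}"] that by blast
  have "frechet_derivative \<phi> (at z) e = 0" if "z \<notin> cball 0 R" for z e
  proof -
    have "((\<lambda>_. 0) has_derivative (\<lambda>_. 0)) (at z)" by simp
    then have "(\<phi> has_derivative (\<lambda>_. 0)) (at z)"
      by (rule has_derivative_transform_within_open[where s="- cball 0 R"]) (use z that in auto)
    then show ?thesis by (simp add: frechet_derivative_at[symmetric])
  qed
  with R(1) z show ?thesis by (rule that)
qed

text \<open>
The partial derivatives are continuous with compact support, hence bounded.
\<close>

lemma test_function_lipschitz:
  assumes \<phi>: "test_function G \<phi>"
  obtains B where "\<And>z w. cmod (\<phi> z - \<phi> w) \<le> B * cmod (z - w)"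
proof -
  obtain R where R: "R > 0" "\<And>z. z \<notin> cball 0 R \<Longrightarrow> \<phi> z = 0"
    "\<And>z e. z \<notin> cball 0 R \<Longrightarrow> frechet_derivative \<phi> (at z) e = 0"
    using test_function_support[OF \<phi>] by metis
  have bnd: "\<exists>B\<ge>0. \<forall>z. cmod (frechet_derivative \<phi> (at z) e) \<le> B"
    if "continuous_on UNIV (\<lambda>z. frechet_derivative \<phi> (at z) e)" for e
  proof -
    have "compact ((\<lambda>z. frechet_derivative \<phi> (at z) e) ` cball 0 R)"
      by (intro compact_continuous_image continuous_on_subset[OF that]) auto
    then obtain B where B: "\<And>z. z \<in> cball 0 R \<Longrightarrow> cmod (frechet_derivative \<phi> (at z) e) \<le> B"
      by (meson compact_imp_bounded bounded_iff imageI)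
    then have "cmod (frechet_derivative \<phi> (at z) e) \<le> max B 0" for z
      using R(3)[of z e] B[of z] by (cases "z \<in> cball 0 R") force+
    then show ?thesis by (intro exI[of _ "max B 0"]) auto
  qed
  obtain Bx By where Bx: "Bx \<ge> 0" "\<And>z. cmod (frechet_derivative \<phi> (at z) 1) \<le> Bx"
    and By: "By \<ge> 0" "\<And>z. cmod (frechet_derivative \<phi> (at z) \<i>) \<le> By"
    using bnd[of 1] bnd[of \<i>] test_function_facts(3,4)[OF \<phi>]
    unfolding partial_x_def[abs_def] partial_y_def[abs_def] by metis
  have der: "(\<phi> has_derivative frechet_derivative \<phi> (at z)) (at z)" for z
    using test_function_facts(1)[OF \<phi>] by (simp add: frechet_derivative_works)
  have "onorm (frechet_derivative \<phi> (at z)) \<le> Bx + By" for z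
  proof (rule onorm_le)
    fix h :: complex
    have lin: "linear (frechet_derivative \<phi> (at z))"
      using has_derivative_bounded_linear[OF der] by (rule bounded_linear.linear)
    have "frechet_derivative \<phi> (at z) h = frechet_derivative \<phi> (at z) (Re h *\<^sub>R 1 + Im h *\<^sub>R \<i>)"
      by (rule arg_cong[where f="frechet_derivative \<phi> (at z)"]) (simp add: complex_eq_iff)
    also have "\<dots> = Re h *\<^sub>R frechet_derivative \<phi> (at z) 1 + Im h *\<^sub>R frechet_derivative \<phi> (at z) \<i>"
      by (simp only: linear_add[OF lin] linear_scale[OF lin])
    also have "cmod \<dots> \<le> \<bar>Re h\<bar> * Bx + \<bar>Im h\<bar> * By"
      using Bx By by (intro norm_triangle_le add_mono) (auto intro!: mult_left_mono)
    also have "\<dots> \<le> cmod h * Bx + cmod h * By"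
      using Bx By abs_Re_le_cmod abs_Im_le_cmod by (intro add_mono mult_right_mono) auto
    finally show "cmod (frechet_derivative \<phi> (at z) h) \<le> (Bx + By) * cmod h" by (simp add: algebra_simps)
  qed
  then have "cmod (\<phi> z - \<phi> w) \<le> (Bx + By) * cmod (z - w)" for z w
    by (intro differentiable_bound[of UNIV \<phi> "\<lambda>z. frechet_derivative \<phi> (at z)"]) (auto intro: der)
  then show ?thesis by (rule that)
qed

text \<open>
Both sides are limits of integrals of difference quotients, which agree by translation invariance of Lebesgue
measure. Dominated convergence applies on the left because the test function is Lipschitz and on the right
because \<open>F\<close> is Lipschitz on a compact neighbourhood of the support.
\<close>

lemma integral_by_parts_direction:
  fixes F :: "complex \<Rightarrow> complex"
  assumes lip: "\<And>K. compact K \<Longrightarrow> \<exists>L. L-lipschitz_on K F"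
    and contF: "continuous_on UNIV F"
    and diff: "AE z in lborel. F differentiable (at z)"
    and \<phi>: "test_function G \<phi>" and e: "cmod e = 1"
  shows "(LINT z|lborel. F z * frechet_derivative \<phi> (at z) e) = - (LINT z|lborel. pointwise_deriv F e z * \<phi> z)"
    and "integrable lborel (\<lambda>z. pointwise_deriv F e z * \<phi> z)"
proof -
  obtain R where R: "R > 0" "\<And>z. z \<notin> cball 0 R \<Longrightarrow> \<phi> z = 0"
    "\<And>z e. z \<notin> cball 0 R \<Longrightarrow> frechet_derivative \<phi> (at z) e = 0"
    using test_function_support[OF \<phi>] by metis
  obtain B where B: "\<And>z w. cmod (\<phi> z - \<phi> w) \<le> B * cmod (z - w)"
    using test_function_lipschitz[OF \<phi>] by metis
  have cont\<phi>: "continuous_on UNIV \<phi>" by (rule test_function_facts[OF \<phi>])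
  \<comment> \<open>Steps have length at most 1, so all points that matter lie in K.\<close>
  define K where "K = cball (0::complex) (R + 1)"
  have K: "compact K" by (simp add: K_def)
  obtain L where L: "L-lipschitz_on K F" using lip[OF K] by blast
  have "compact (F ` K)" "compact (\<phi> ` K)"
    using K by (auto intro!: compact_continuous_image continuous_on_subset[OF contF] continuous_on_subset[OF cont\<phi>])
  then obtain MF MP where MF: "\<And>z. z \<in> K \<Longrightarrow> cmod (F z) \<le> MF" and MP: "\<And>z. z \<in> K \<Longrightarrow> cmod (\<phi> z) \<le> MP"
    by (metis compact_imp_bounded bounded_iff imageI)
  define c where "c = (\<lambda>n. e / of_nat (Suc n) :: complex)"
  have cn: "cmod (c n) = 1 / real (Suc n)" "cmod (c n) \<le> 1" for n
    using e by (auto simp: c_def norm_divide simp del: of_nat_Suc)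
  have out: "z + c n \<notin> cball 0 R" "z \<notin> cball 0 R" if "z \<notin> K" for z n
  proof -
    have "cmod z \<le> cmod (z + c n) + cmod (c n)" by (metis add_diff_cancel_right' norm_triangle_ineq4)
    then show "z + c n \<notin> cball 0 R" "z \<notin> cball 0 R" using that cn(2)[of n] by (auto simp: K_def)
  qed
  have intK: "integrable lborel (\<lambda>z. indicator K z *\<^sub>R (M::real))" for M
    using K by (intro borel_integrable_compact) auto
  define a b where "a = (\<lambda>n z. F z * (of_nat (Suc n) * (\<phi> (z + c n) - \<phi> z)))"
    and "b = (\<lambda>n z. diff_quotient F e n z * \<phi> z)"
  have contb: "continuous_on UNIV (\<lambda>z. F (z - c n))" "continuous_on UNIV (\<lambda>z. \<phi> (z + c n))" for n
    by (auto intro!: continuous_on_compose2[OF contF] continuous_on_compose2[OF cont\<phi>] continuous_intros)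
  have ab: "(LINT z|lborel. a n z) = - (LINT z|lborel. b n z)" for n
  proof -
    have i1: "integrable lborel (\<lambda>z. F z * \<phi> (z + c n))"
      using out R(2) by (intro integrable_continuous_compact_support[where R="R+1"] continuous_intros contF contb)
         (auto simp: K_def)
    have i2: "integrable lborel (\<lambda>z. F z * \<phi> z)"
      using out R(2) by (intro integrable_continuous_compact_support[where R="R+1"] continuous_intros contF cont\<phi>)
         (auto simp: K_def)
    have i3: "integrable lborel (\<lambda>z. F (z - c n) * \<phi> z)"
      using out R(2) by (intro integrable_continuous_compact_support[where R="R+1"] continuous_intros contb cont\<phi>)
         (auto simp: K_def)
    have "(LINT z|lborel. a n z) = (LINT z|lborel. of_nat (Suc n) * (F z * \<phi> (z + c n) - F z * \<phi> z))"
      by (simp add: a_def algebra_simps)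
    also have "\<dots> = of_nat (Suc n) * ((LINT z|lborel. F z * \<phi> (z + c n)) - (LINT z|lborel. F z * \<phi> z))"
      using i1 i2 by simp
    also have "(LINT z|lborel. F z * \<phi> (z + c n)) = (LINT z|lborel. F (z - c n) * \<phi> z)"
      using integral_translate[of "\<lambda>z. F (z - c n) * \<phi> z" "c n"] contb cont\<phi>
      by (simp add: continuous_on_mult)
    also have "of_nat (Suc n) * ((LINT z|lborel. F (z - c n) * \<phi> z) - (LINT z|lborel. F z * \<phi> z))
       = - (of_nat (Suc n) * ((LINT z|lborel. F z * \<phi> z) - (LINT z|lborel. F (z - c n) * \<phi> z)))" by (simp add: algebra_simps)
    also have "\<dots> = - (LINT z|lborel. of_nat (Suc n) * (F z * \<phi> z - F (z - c n) * \<phi> z))"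
      using i2 i3 by simp
    also have "\<dots> = - (LINT z|lborel. b n z)"
      by (simp add: b_def diff_quotient_def c_def algebra_simps)
    finally show ?thesis .
  qed
  have der: "(\<phi> has_derivative frechet_derivative \<phi> (at z)) (at z)" for z
    using test_function_facts(1)[OF \<phi>] by (simp add: frechet_derivative_works)
  have lima: "(\<lambda>n. a n z) \<longlonglongrightarrow> F z * frechet_derivative \<phi> (at z) e" for z
    unfolding a_def c_def by (intro tendsto_mult_left directional_quotient_tendsto der)
  have am: "a n \<in> borel_measurable lborel" for n
    unfolding a_def by (auto intro!: borel_measurable_continuous_onI continuous_intros contF cont\<phi> contb)
  have Alim: "(\<lambda>n. LINT z|lborel. a n z) \<longlonglongrightarrow> (LINT z|lborel. F z * frechet_derivative \<phi> (at z) e)"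
  proof (rule integral_dominated_convergence[where w="\<lambda>z. indicator K z *\<^sub>R (MF * B)"])
    show "(\<lambda>z. F z * frechet_derivative \<phi> (at z) e) \<in> borel_measurable lborel"
      by (rule borel_measurable_LIMSEQ_metric[OF am lima])
    show "AE z in lborel. cmod (a n z) \<le> indicator K z *\<^sub>R (MF * B)" for n
    proof (rule AE_I2)
      fix z
      show "cmod (a n z) \<le> indicator K z *\<^sub>R (MF * B)"
      proof (cases "z \<in> K")
        case True
        have "cmod (\<phi> (z + c n) - \<phi> z) \<le> B * (1 / real (Suc n))"
          using B[of "z + c n" z] by (simp add: cn)
        then have "real (Suc n) * cmod (\<phi> (z + c n) - \<phi> z) \<le> B" by (simp add: field_simps)
        then have "cmod (F z) * (real (Suc n) * cmod (\<phi> (z + c n) - \<phi> z)) \<le> MF * B"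
          using MF[OF True] by (intro mult_mono) (auto intro: order_trans[OF norm_ge_zero])
        then show ?thesis using True by (simp add: a_def norm_mult del: of_nat_Suc)
      qed (use out R(2) in \<open>simp add: a_def\<close>)
    qed
  qed (use am intK lima in auto)
  have b_eq: "b n = (\<lambda>z. of_nat (Suc n) * (F z - F (z - c n)) * \<phi> z)" for n
    by (simp only: b_def diff_quotient_def c_def)
  have "b n \<in> borel_measurable borel" for n
    unfolding b_eq by (intro borel_measurable_continuous_onI continuous_intros contF cont\<phi> contb)
  then have bm: "b n \<in> borel_measurable lborel" for n by simp
  have gm: "(\<lambda>z. pointwise_deriv F e z * \<phi> z) \<in> borel_measurable lborel"
    using borel_measurable_pointwise_deriv[OF contF] borel_measurable_continuous_onI[OF cont\<phi>] by simp
  have limb: "AE z in lborel. (\<lambda>n. b n z) \<longlonglongrightarrow> pointwise_deriv F e z * \<phi> z"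
    using diff
  proof (rule AE_mp, intro AE_I2 impI)
    fix z assume "F differentiable (at z)"
    then obtain D where D: "(F has_derivative D) (at z)" by (auto simp: differentiable_def)
    show "(\<lambda>n. b n z) \<longlonglongrightarrow> pointwise_deriv F e z * \<phi> z"
      unfolding b_def pointwise_deriv_eq[OF D] by (intro tendsto_mult_right diff_quotient_tendsto D)
  qed
  have bb: "AE z in lborel. cmod (b n z) \<le> indicator K z *\<^sub>R (L * MP)" for n
  proof (rule AE_I2)
    fix z
    show "cmod (b n z) \<le> indicator K z *\<^sub>R (L * MP)"
    proof (cases "z \<in> cball 0 R")
      case True
      have "cmod (z - c n) \<le> cmod z + cmod (c n)" by (rule norm_triangle_ineq4)
      then have zK: "z \<in> K" "z - c n \<in> K" using True cn(2)[of n] by (auto simp: K_def)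
      have "cmod (F z - F (z - c n)) \<le> L * (1 / real (Suc n))"
        using lipschitz_onD[OF L zK] by (simp add: dist_norm cn)
      then have "real (Suc n) * cmod (F z - F (z - c n)) \<le> L" by (simp add: field_simps)
      then have "(real (Suc n) * cmod (F z - F (z - c n))) * cmod (\<phi> z) \<le> L * MP"
        using MP[OF zK(1)] lipschitz_on_nonneg[OF L] by (intro mult_mono) auto
      then show ?thesis using zK by (simp add: b_def diff_quotient_def c_def norm_mult del: of_nat_Suc)
    next
      case False
      have "0 \<le> L * MP" using lipschitz_on_nonneg[OF L] MP[of 0] R(1) order_trans[OF norm_ge_zero]
        by (intro mult_nonneg_nonneg) (auto simp: K_def)
      then show ?thesis using False R(2) by (simp add: b_def indicator_def)
    qed
  qed
  have Blim: "(\<lambda>n. LINT z|lborel. b n z) \<longlonglongrightarrow> (LINT z|lborel. pointwise_deriv F e z * \<phi> z)"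
    by (rule integral_dominated_convergence[OF gm bm intK limb bb])
  show "integrable lborel (\<lambda>z. pointwise_deriv F e z * \<phi> z)"
    by (rule integrable_dominated_convergence[OF gm bm intK limb bb])
  from tendsto_minus[OF Blim] have "(\<lambda>n. LINT z|lborel. a n z) \<longlonglongrightarrow> - (LINT z|lborel. pointwise_deriv F e z * \<phi> z)"
    by (simp add: ab)
  with Alim show "(LINT z|lborel. F z * frechet_derivative \<phi> (at z) e) = - (LINT z|lborel. pointwise_deriv F e z * \<phi> z)"
    by (rule LIMSEQ_unique)
qed

lemma locally_integrable_pointwise_deriv:
  fixes F :: "complex \<Rightarrow> complex"
  assumes lip: "\<And>K. compact K \<Longrightarrow> \<exists>L. L-lipschitz_on K F"
    and contF: "continuous_on UNIV F"
    and diff: "AE z in lborel. F differentiable (at z)" and e: "cmod e = 1"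
  shows "locally_integrable_on (pointwise_deriv F e) UNIV"
  unfolding locally_integrable_on_def
proof (intro allI impI, elim conjE)
  fix K :: "complex set" assume K: "compact K"
  then obtain R where R: "K \<subseteq> cball 0 R"
    by (meson bounded_subset_ballD ball_subset_cball order_trans compact_imp_bounded)
  obtain L where L: "L-lipschitz_on (cball 0 (R + 1)) F" using lip[of "cball 0 (R + 1)"] by auto
  show "pointwise_deriv F e absolutely_integrable_on K"
  proof (rule absolutely_integrable_on_compact_bounded[OF borel_measurable_pointwise_deriv[OF contF] K, where B=L])
    show "AE z in lborel. z \<in> K \<longrightarrow> cmod (pointwise_deriv F e z) \<le> L"
      using diff
    proof (rule AE_mp, intro AE_I2 impI)
      fix z assume "F differentiable (at z)" and z: "z \<in> K"
      then obtain D where D: "(F has_derivative D) (at z)" by (auto simp: differentiable_def)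
      have "cmod (diff_quotient F e n z) \<le> L" for n
      proof -
        define c where "c = e / of_nat (Suc n)"
        have cn: "cmod c = 1 / real (Suc n)" "cmod c \<le> 1"
          using e by (auto simp: c_def norm_divide simp del: of_nat_Suc)
        have "cmod (z - c) \<le> cmod z + cmod c" by (rule norm_triangle_ineq4)
        then have zK: "z \<in> cball 0 (R + 1)" "z - c \<in> cball 0 (R + 1)" using z R cn(2) by auto
        have "cmod (F z - F (z - c)) \<le> L * (1 / real (Suc n))"
          using lipschitz_onD[OF L zK] by (simp add: dist_norm cn)
        then have "real (Suc n) * cmod (F z - F (z - c)) \<le> L" by (simp add: field_simps)
        then show ?thesis by (simp add: diff_quotient_def c_def norm_mult del: of_nat_Suc)
      qed
      then show "cmod (pointwise_deriv F e z) \<le> L"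
        unfolding pointwise_deriv_eq[OF D]
        using tendsto_norm[OF diff_quotient_tendsto[OF D, of e]] by (intro LIMSEQ_le_const2) auto
    qed
  qed
qed

lemma locally_integrable_continuous:
  assumes "continuous_on UNIV F"
  shows "locally_integrable_on F UNIV"
  unfolding locally_integrable_on_def
proof (intro allI impI, elim conjE)
  fix K :: "complex set" assume K: "compact K"
  then have "compact (F ` K)" by (intro compact_continuous_image continuous_on_subset[OF assms]) auto
  then obtain B where "\<And>z. z \<in> K \<Longrightarrow> cmod (F z) \<le> B" by (meson compact_imp_bounded bounded_iff imageI)
  then show "F absolutely_integrable_on K"
    by (intro absolutely_integrable_on_compact_bounded[where B=B] borel_measurable_continuous_onI assms K) auto
qed

lemma locally_integrable_combination:
  assumes g: "locally_integrable_on g G" and h: "locally_integrable_on h G"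
  shows "locally_integrable_on (\<lambda>z. (g z + c * h z) / 2) G"
  unfolding locally_integrable_on_def
proof (intro allI impI)
  fix K assume K: "compact K \<and> K \<subseteq> G"
  then have "set_integrable lebesgue K g" "set_integrable lebesgue K h"
    using g h by (auto simp: locally_integrable_on_def)
  then have "set_integrable lebesgue K (\<lambda>z. g z + c * h z)"
    by (intro set_integral_add(1)) auto
  then show "(\<lambda>z. (g z + c * h z) / 2) absolutely_integrable_on K"
    by (rule set_integrable_divide)
qed

lemma has_dist_deriv_pointwise:
  fixes F :: "complex \<Rightarrow> complex"
  assumes lip: "\<And>K. compact K \<Longrightarrow> \<exists>L. L-lipschitz_on K F"
    and contF: "continuous_on UNIV F"
    and diff: "AE z in lborel. F differentiable (at z)"
  shows "has_dist_deriv_z F (\<lambda>z. (pointwise_deriv F 1 z - \<i> * pointwise_deriv F \<i> z) / 2) UNIV"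
    and "has_dist_deriv_zbar F (\<lambda>z. (pointwise_deriv F 1 z + \<i> * pointwise_deriv F \<i> z) / 2) UNIV"
proof -
  note li = locally_integrable_pointwise_deriv[OF lip contF diff]
  have comb: "locally_integrable_on (\<lambda>z. (pointwise_deriv F 1 z + c * pointwise_deriv F \<i> z) / 2) UNIV" for c
    by (intro locally_integrable_combination li) auto
  have main: "(LINT z|lebesgue. F z * ((partial_x \<phi> z + c * partial_y \<phi> z) / 2))
      = - (LINT z|lebesgue. (pointwise_deriv F 1 z + c * pointwise_deriv F \<i> z) / 2 * \<phi> z)"
    if \<phi>: "test_function UNIV \<phi>" for \<phi> c
  proof -
    note ibp = integral_by_parts_direction[OF lip contF diff \<phi>]
    obtain R where R: "\<And>z. z \<notin> cball 0 R \<Longrightarrow> \<phi> z = 0"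
      "\<And>z e. z \<notin> cball 0 R \<Longrightarrow> frechet_derivative \<phi> (at z) e = 0"
      using test_function_support[OF \<phi>] by metis
    note tf = test_function_facts[OF \<phi>]
    have px: "partial_x \<phi> z = 0" "partial_y \<phi> z = 0" if "z \<notin> cball 0 R" for z
      using R(2)[OF that] by (simp_all add: partial_x_def partial_y_def)
    have ix: "integrable lborel (\<lambda>z. F z * partial_x \<phi> z)"
      by (intro integrable_continuous_compact_support[where R=R] continuous_on_mult contF tf) (use px in force)
    have iy: "integrable lborel (\<lambda>z. F z * partial_y \<phi> z)"
      by (intro integrable_continuous_compact_support[where R=R] continuous_on_mult contF tf) (use px in force)
    have "(LINT z|lebesgue. F z * ((partial_x \<phi> z + c * partial_y \<phi> z) / 2))
        = (LINT z|lborel. F z * ((partial_x \<phi> z + c * partial_y \<phi> z) / 2))"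
      by (intro integral_completion) (auto intro!: borel_measurable_continuous_onI continuous_intros contF tf)
    also have "\<dots> = (LINT z|lborel. (F z * partial_x \<phi> z + c * (F z * partial_y \<phi> z)) / 2)"
      by (simp add: algebra_simps)
    also have "\<dots> = ((LINT z|lborel. F z * partial_x \<phi> z) + c * (LINT z|lborel. F z * partial_y \<phi> z)) / 2"
      using ix iy by simp
    also have "\<dots> = - (((LINT z|lborel. pointwise_deriv F 1 z * \<phi> z) + c * (LINT z|lborel. pointwise_deriv F \<i> z * \<phi> z)) / 2)"
      using ibp(1)[of 1] ibp(1)[of \<i>] by (simp add: partial_x_def partial_y_def algebra_simps)
    also have "\<dots> = - (LINT z|lborel. (pointwise_deriv F 1 z * \<phi> z + c * (pointwise_deriv F \<i> z * \<phi> z)) / 2)"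
      using ibp(2)[of 1] ibp(2)[of \<i>] by simp
    also have "\<dots> = - (LINT z|lborel. (pointwise_deriv F 1 z + c * pointwise_deriv F \<i> z) / 2 * \<phi> z)"
      by (simp add: algebra_simps)
    also have "\<dots> = - (LINT z|lebesgue. (pointwise_deriv F 1 z + c * pointwise_deriv F \<i> z) / 2 * \<phi> z)"
      using borel_measurable_pointwise_deriv[OF contF] borel_measurable_continuous_onI[OF tf(2)]
      by (subst integral_completion) auto
    finally show ?thesis .
  qed
  show "has_dist_deriv_z F (\<lambda>z. (pointwise_deriv F 1 z - \<i> * pointwise_deriv F \<i> z) / 2) UNIV"
    using comb[of "-\<i>"] main[of _ "-\<i>"] locally_integrable_continuous[OF contF]
    by (simp add: has_dist_deriv_z_def wirtinger_z_def set_lebesgue_integral_def)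
  show "has_dist_deriv_zbar F (\<lambda>z. (pointwise_deriv F 1 z + \<i> * pointwise_deriv F \<i> z) / 2) UNIV"
    using comb[of \<i>] main[of _ \<i>] locally_integrable_continuous[OF contF]
    by (simp add: has_dist_deriv_zbar_def wirtinger_zbar_def set_lebesgue_integral_def)
qed

section \<open>Extending a half-plane map by translations\<close>

definition half_plane_proj :: "complex \<Rightarrow> complex" where
  "half_plane_proj \<zeta> = Complex (min (Re \<zeta>) 0) (Im \<zeta>)"

text \<open>
The extension of \<open>M\<close> from the closed left half-plane that moves the boundary values by horizontal
translation; in the variable \<open>exp \<zeta>\<close> the translations are the Loewner flow.
\<close>

definition shift_extension :: "(complex \<Rightarrow> complex) \<Rightarrow> complex \<Rightarrow> complex" where
  "shift_extension M \<zeta> = M (half_plane_proj \<zeta>) + of_real (max (Re \<zeta>) 0)"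

lemma Re_half_plane_proj: "Re (half_plane_proj \<zeta>) \<le> 0"
  by (simp add: half_plane_proj_def)

lemma half_plane_proj_contraction:
  "cmod (half_plane_proj x - half_plane_proj y) \<le> cmod (x - y)"
proof -
  have "\<bar>min (Re x) 0 - min (Re y) 0\<bar> \<le> \<bar>Re x - Re y\<bar>" by auto
  then have "(min (Re x) 0 - min (Re y) 0)\<^sup>2 \<le> (Re x - Re y)\<^sup>2" by (simp add: abs_le_square_iff)
  then show ?thesis by (simp add: cmod_def half_plane_proj_def)
qed

text \<open>
The hypothesis holds when the derivative of \<open>M\<close> stays within distance \<open>R\<close> of the positive number
\<open>w\<close>. As a condition on difference quotients it passes to the boundary, where \<open>M\<close> need not be
differentiable.
\<close>

locale nearly_linear =
  fixes M :: "complex \<Rightarrow> complex" and w R :: real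
  assumes near: "Re x \<le> 0 \<Longrightarrow> Re y \<le> 0 \<Longrightarrow> cmod (M x - M y - of_real w * (x - y)) \<le> R * cmod (x - y)"
    and w: "0 < w" and R: "0 \<le> R" "R < w"
begin

lemma shift_extension_lipschitz: "(R + w + 1)-lipschitz_on UNIV (shift_extension M)"
proof (rule lipschitz_onI)
  fix x y
  let ?p = "half_plane_proj x" and ?q = "half_plane_proj y"
  have "cmod (M ?p - M ?q) \<le> cmod (M ?p - M ?q - of_real w * (?p - ?q)) + cmod (of_real w * (?p - ?q))"
    by (metis diff_add_cancel norm_triangle_ineq)
  also have "\<dots> \<le> R * cmod (?p - ?q) + w * cmod (?p - ?q)"
    using near[OF Re_half_plane_proj Re_half_plane_proj, of x y] w by (simp add: norm_mult)
  also have "\<dots> \<le> (R + w) * cmod (x - y)"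
    using half_plane_proj_contraction[of x y] w R by (simp add: mult_left_mono flip: distrib_right)
  finally have 1: "cmod (M ?p - M ?q) \<le> (R + w) * cmod (x - y)" .
  have "\<bar>max (Re x) 0 - max (Re y) 0\<bar> \<le> \<bar>Re (x - y)\<bar>" by auto
  then have 2: "cmod (of_real (max (Re x) 0) - of_real (max (Re y) 0)) \<le> cmod (x - y)"
    using abs_Re_le_cmod[of "x - y"] by (simp only: norm_of_real flip: of_real_diff)
  have "shift_extension M x - shift_extension M y = (M ?p - M ?q) + (of_real (max (Re x) 0) - of_real (max (Re y) 0))"
    by (simp add: shift_extension_def)
  then show "dist (shift_extension M x) (shift_extension M y) \<le> (R + w + 1) * dist x y"
    using norm_triangle_le[OF add_mono[OF 1 2]] by (simp only: dist_norm) (simp add: algebra_simps)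
qed (use w R in simp)

lemma strongly_monotone:
  assumes "Re x \<le> 0" "Re y \<le> 0"
  shows "(w - R) * (cmod (x - y))\<^sup>2 \<le> Re (cnj (x - y) * (M x - M y))"
proof -
  define h where "h = x - y"
  have "cmod (cnj h * (M x - M y - of_real w * h)) \<le> cmod h * (R * cmod h)"
    using near[OF assms] by (simp add: norm_mult h_def mult_left_mono del: complex_cnj_diff)
  moreover have "cnj h * (M x - M y - of_real w * h) = cnj h * (M x - M y) - of_real (w * (cmod h)\<^sup>2)"
    by (simp only: of_real_mult complex_norm_square) (simp add: algebra_simps)
  ultimately have "cmod (cnj h * (M x - M y) - of_real (w * (cmod h)\<^sup>2)) \<le> R * (cmod h)\<^sup>2"
    by (simp add: power2_eq_square mult_ac)
  with abs_Re_le_cmod[of "cnj h * (M x - M y) - of_real (w * (cmod h)\<^sup>2)"]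
  have "\<bar>Re (cnj h * (M x - M y)) - w * (cmod h)\<^sup>2\<bar> \<le> R * (cmod h)\<^sup>2" by simp
  then have "w * (cmod h)\<^sup>2 - R * (cmod h)\<^sup>2 \<le> Re (cnj h * (M x - M y))" by linarith
  then show ?thesis by (simp add: h_def algebra_simps)
qed

text \<open>
If two values agree, the boundary parts differ by the real number \<open>d\<close>, the difference of the translation
lengths. Both \<open>min (Re \<zeta>) 0\<close> and \<open>max (Re \<zeta>) 0\<close> increase with \<open>Re \<zeta>\<close>, so \<open>d\<close> has the sign
opposite to that of the real part of the difference of the projected points, which strong monotonicity excludes.
\<close>

lemma inj_shift_extension: "inj (shift_extension M)"
proof (rule injI)
  fix x y assume eq: "shift_extension M x = shift_extension M y"
  define p q where "p = half_plane_proj x" and "q = half_plane_proj y"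
  define d where "d = max (Re y) 0 - max (Re x) 0"
  have pq: "Re p \<le> 0" "Re q \<le> 0" by (simp_all add: p_def q_def Re_half_plane_proj)
  have M: "M p - M q = of_real d"
    using eq by (simp add: shift_extension_def p_def q_def d_def algebra_simps)
  have "(w - R) * (cmod (p - q))\<^sup>2 \<le> Re (cnj (p - q) * of_real d)"
    using strongly_monotone[OF pq] by (simp only: M)
  also have "\<dots> = (min (Re x) 0 - min (Re y) 0) * d"
    by (simp add: p_def q_def half_plane_proj_def)
  also have "\<dots> \<le> 0"
    by (cases "Re x \<le> Re y") (auto simp: d_def mult_le_0_iff)
  finally have "cmod (p - q) = 0" using R by (simp add: mult_le_0_iff)
  then have "p = q" by simp
  with M have "d = 0" by simp
  with \<open>p = q\<close> show "x = y"
    by (auto simp: p_def q_def d_def half_plane_proj_def complex_eq_iff min_def max_def split: if_splits)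
qed

text \<open>
The number \<open>i * Q\<close> is the derivative of the boundary curve. It lies in the closed disc because all
difference quotients do.
\<close>

lemma shift_extension_has_derivative:
  assumes \<zeta>: "Re \<zeta> > 0" and diff: "(\<lambda>\<theta>. M (\<i> * of_real \<theta>)) differentiable (at (Im \<zeta>))"
  obtains Q where "cmod (Q - of_real w) \<le> R"
    "(shift_extension M has_derivative (\<lambda>h. of_real (Re h) + \<i> * Q * of_real (Im h))) (at \<zeta>)"
proof -
  define N where "N = (\<lambda>\<theta>. M (\<i> * of_real \<theta>))"
  obtain V where V: "(N has_vector_derivative V) (at (Im \<zeta>))"
    using diff unfolding N_def by (auto simp: vector_derivative_works)
  define Q where "Q = V / \<i>"
  have iQ: "\<i> * Q = V" by (simp add: Q_def)
  have "((\<lambda>y. (N y - N (Im \<zeta>)) /\<^sub>R (y - Im \<zeta>)) \<longlongrightarrow> V) (at (Im \<zeta>))"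
    by (rule has_vector_derivative_quotient_tendsto[OF V])
  then have lim: "((\<lambda>y. (N y - N (Im \<zeta>)) /\<^sub>R (y - Im \<zeta>) - \<i> * of_real w) \<longlongrightarrow> V - \<i> * of_real w) (at (Im \<zeta>))"
    by (intro tendsto_diff tendsto_const)
  have "cmod ((N y - N x) /\<^sub>R (y - x) - \<i> * of_real w) \<le> R" if "y \<noteq> x" for x y
  proof -
    have "cmod (N y - N x - of_real w * (\<i> * of_real y - \<i> * of_real x)) \<le> R * cmod (\<i> * of_real y - \<i> * of_real x)"
      unfolding N_def by (intro near) auto
    moreover have "\<i> * of_real y - \<i> * of_real x = \<i> * complex_of_real (y - x)" by (simp add: algebra_simps)
    ultimately have *: "cmod (N y - N x - of_real w * (\<i> * complex_of_real (y - x))) \<le> R * \<bar>y - x\<bar>"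
      by (simp only: norm_mult norm_of_real norm_ii mult_1_left)
    have "(N y - N x) /\<^sub>R (y - x) - \<i> * of_real w = (N y - N x - of_real w * (\<i> * complex_of_real (y - x))) /\<^sub>R (y - x)"
      using that by (simp add: scaleR_conv_of_real field_simps)
    then have "cmod ((N y - N x) /\<^sub>R (y - x) - \<i> * of_real w) = cmod (N y - N x - of_real w * (\<i> * complex_of_real (y - x))) / \<bar>y - x\<bar>"
      by (simp add: divide_inverse mult.commute)
    also have "\<dots> \<le> R" using * that by (simp add: field_simps)
    finally show ?thesis .
  qed
  then have "cmod (V - \<i> * of_real w) \<le> R"
    by (intro tendsto_upperbound[OF tendsto_norm[OF lim]]) (auto simp: eventually_at_filter)
  moreover have "V - \<i> * of_real w = \<i> * (Q - of_real w)" by (simp add: iQ[symmetric] algebra_simps)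
  ultimately have Q: "cmod (Q - of_real w) \<le> R" by (simp add: norm_mult)
  have dN: "(N has_derivative (\<lambda>t. t *\<^sub>R V)) (at (Im \<zeta>))"
    using V by (simp add: has_vector_derivative_def)
  have "((\<lambda>\<xi>. N (Im \<xi>)) has_derivative (\<lambda>h. Im h *\<^sub>R V)) (at \<zeta>)"
    by (rule has_derivative_compose[of Im Im \<zeta> UNIV N "\<lambda>t. t *\<^sub>R V", OF bounded_linear_imp_has_derivative[OF bounded_linear_Im] dN])
  then have "((\<lambda>\<xi>. N (Im \<xi>) + of_real (Re \<xi>)) has_derivative (\<lambda>h. Im h *\<^sub>R V + of_real (Re h))) (at \<zeta>)"
    by (intro derivative_intros) auto
  then have "(shift_extension M has_derivative (\<lambda>h. Im h *\<^sub>R V + of_real (Re h))) (at \<zeta>)"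
  proof (rule has_derivative_transform_within_open)
    show "open {\<xi>. Re \<xi> > 0}" by (rule open_halfspace_Re_gt)
    show "N (Im \<xi>) + of_real (Re \<xi>) = shift_extension M \<xi>" if "\<xi> \<in> {\<xi>. Re \<xi> > 0}" for \<xi>
    proof -
      have "half_plane_proj \<xi> = \<i> * of_real (Im \<xi>)" using that by (simp add: half_plane_proj_def complex_eq_iff)
      then show ?thesis using that by (simp add: shift_extension_def N_def)
    qed
  qed (use \<zeta> in simp)
  then have "(shift_extension M has_derivative (\<lambda>h. of_real (Re h) + \<i> * Q * of_real (Im h))) (at \<zeta>)"
    by (simp only: iQ scaleR_conv_of_real mult.commute add.commute)
  with Q show ?thesis by (rule that)
qed

end

lemma closure_left_half_plane: "closure {z::complex. Re z < 0} = {z. Re z \<le> 0}"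
  using closure_halfspace_lt[of "1::complex" 0] by (simp add: inner_complex_def)

text \<open>
The function \<open>M \<zeta> - w * \<zeta>\<close> has derivative bounded by \<open>R\<close> on a convex set, so it is \<open>R\<close>-Lipschitz and
extends to the closure. Periodicity of \<open>exp\<close> gives the translation rule inside, and continuity carries it to
the boundary.
\<close>

lemma half_plane_boundary_extension:
  fixes g :: "complex \<Rightarrow> complex" and c :: complex and w R :: real
  assumes g: "g holomorphic_on ball 0 1" and c: "c \<noteq> 0" and R: "0 \<le> R"
    and b: "\<And>z. z \<in> ball 0 1 \<Longrightarrow> cmod ((1 + z * deriv g z) / c - of_real w) \<le> R"
  obtains M where "\<And>x y. Re x \<le> 0 \<Longrightarrow> Re y \<le> 0 \<Longrightarrow> cmod (M x - M y - of_real w * (x - y)) \<le> R * cmod (x - y)"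
    and "\<And>\<zeta>. Re \<zeta> < 0 \<Longrightarrow> M \<zeta> = (\<zeta> + g (exp \<zeta>)) / c"
    and "\<And>\<zeta>. Re \<zeta> \<le> 0 \<Longrightarrow> M (\<zeta> + of_real (2 * pi) * \<i>) = M \<zeta> + of_real (2 * pi) * \<i> / c"
proof -
  define H where "H = {z::complex. Re z < 0}"
  have cl: "closure H = {z. Re z \<le> 0}" unfolding H_def by (rule closure_left_half_plane)
  define P where "P = (\<lambda>\<zeta>. (\<zeta> + g (exp \<zeta>)) / c - of_real w * \<zeta>)"
  have ex: "exp \<zeta> \<in> ball 0 1" if "\<zeta> \<in> H" for \<zeta> :: complex using that by (simp add: H_def)
  have dP: "(P has_field_derivative (1 + exp \<zeta> * deriv g (exp \<zeta>)) / c - of_real w) (at \<zeta> within H)" if "\<zeta> \<in> H" for \<zeta>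
  proof -
    have "((\<lambda>\<xi>. g (exp \<xi>)) has_field_derivative deriv g (exp \<zeta>) * exp \<zeta>) (at \<zeta>)"
      by (rule DERIV_chain2[OF holomorphic_derivI[OF g open_ball ex[OF that]] DERIV_exp])
    then have "(P has_field_derivative (1 + deriv g (exp \<zeta>) * exp \<zeta>) / c - of_real w * 1) (at \<zeta>)"
      unfolding P_def by (intro DERIV_diff DERIV_cdivide DERIV_add DERIV_ident DERIV_cmult)
    then show ?thesis by (simp add: has_field_derivative_at_within mult.commute)
  qed
  have "R-lipschitz_on H P"
  proof (rule lipschitz_onI)
    fix x y assume "x \<in> H" "y \<in> H"
    then show "dist (P x) (P y) \<le> R * dist x y"
      unfolding dist_norm
      by (intro field_differentiable_bound[OF _ dP b[OF ex]]) (auto simp: H_def convex_halfspace_Re_lt)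
  qed (rule R)
  then obtain P' where P': "R-lipschitz_on (closure H) P'" "\<And>\<zeta>. \<zeta> \<in> H \<Longrightarrow> P' \<zeta> = P \<zeta>"
    using lipschitz_extend_closure by metis
  define T where "T = of_real (2 * pi) * \<i>"
  have ReT: "Re T = 0" by (simp add: T_def)
  have expT: "exp (\<zeta> + T) = exp \<zeta>" for \<zeta> using exp_eq[of "\<zeta> + T" \<zeta>] by (auto simp: T_def intro!: exI[of _ 1])
  have cont: "continuous_on (closure H) P'" by (rule lipschitz_on_continuous_on[OF P'(1)])
  have per: "P' (\<zeta> + T) - P' \<zeta> = T / c - of_real w * T" if "\<zeta> \<in> closure H" for \<zeta>
  proof (rule continuous_constant_on_closure[OF _ _ that])
    show "continuous_on (closure H) (\<lambda>\<zeta>. P' (\<zeta> + T) - P' \<zeta>)"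
      by (intro continuous_on_diff cont continuous_on_compose2[OF cont] continuous_intros) (auto simp: cl ReT)
    show "P' (\<zeta> + T) - P' \<zeta> = T / c - of_real w * T" if "\<zeta> \<in> H" for \<zeta>
    proof -
      have "\<zeta> + T \<in> H" using that by (simp add: H_def ReT)
      then have "P' (\<zeta> + T) - P' \<zeta> = P (\<zeta> + T) - P \<zeta>" using that by (simp only: P'(2))
      also have "\<dots> = T / c - of_real w * T"
        unfolding P_def expT by (simp add: add_divide_distrib algebra_simps)
      finally show ?thesis .
    qed
  qed
  show ?thesis
  proof (rule that[of "\<lambda>\<zeta>. P' \<zeta> + of_real w * \<zeta>"])
    fix x y assume "Re x \<le> 0" "Re y \<le> 0"
    then have "cmod (P' x - P' y) \<le> R * cmod (x - y)"
      using lipschitz_onD[OF P'(1), of x y] by (simp add: cl dist_norm)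
    then show "cmod (P' x + of_real w * x - (P' y + of_real w * y) - of_real w * (x - y)) \<le> R * cmod (x - y)"
      by (simp add: algebra_simps)
  next
    fix \<zeta> assume "Re \<zeta> < 0"
    then show "P' \<zeta> + of_real w * \<zeta> = (\<zeta> + g (exp \<zeta>)) / c" by (simp add: P'(2) H_def P_def)
  next
    fix \<zeta> assume "Re \<zeta> \<le> 0"
    then show "P' (\<zeta> + of_real (2 * pi) * \<i>) + of_real w * (\<zeta> + of_real (2 * pi) * \<i>) = P' \<zeta> + of_real w * \<zeta> + of_real (2 * pi) * \<i> / c"
      unfolding T_def[symmetric] using per[of \<zeta>] by (simp add: cl algebra_simps)
  qed
qed

section \<open>From the logarithmic coordinate to the plane\<close>

lemma holomorphic_lipschitz_on_compact:
  assumes hol: "f holomorphic_on A" and A: "open A" and K: "compact K" "convex K" "K \<subseteq> A"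
  shows "\<exists>L. L-lipschitz_on K f"
proof -
  have "continuous_on K (deriv f)"
    using holomorphic_deriv[OF hol A] K by (meson continuous_on_subset holomorphic_on_imp_continuous_on)
  then have "bounded (deriv f ` K)" using K by (simp add: compact_continuous_image compact_imp_bounded)
  then obtain B where B: "B > 0" "\<And>z. z \<in> K \<Longrightarrow> cmod (deriv f z) \<le> B" by (auto simp: bounded_pos)
  have der: "(f has_field_derivative deriv f z) (at z within K)" if "z \<in> K" for z
    using holomorphic_derivI[OF hol A, of z] K(3) that by (blast intro: has_field_derivative_at_within)
  have "B-lipschitz_on K f"
  proof (rule lipschitz_onI)
    fix x y assume "x \<in> K" "y \<in> K"
    then show "dist (f x) (f y) \<le> B * dist x y"
      unfolding dist_norm by (intro field_differentiable_bound[OF K(2) der B(2)])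
  qed (use B in simp)
  then show ?thesis by blast
qed

text \<open>
The map \<open>exp \<zeta> \<mapsto> exp (c * S \<zeta>)\<close>, which is well defined when \<open>S\<close> commutes with the periods as in the
locale below; the principal logarithm is just one choice of \<open>\<zeta>\<close>.
\<close>

definition exp_conjugate :: "complex \<Rightarrow> (complex \<Rightarrow> complex) \<Rightarrow> complex \<Rightarrow> complex" where
  "exp_conjugate c S z = (if z = 0 then 0 else exp (c * S (Ln z)))"

locale periodic_map =
  fixes c :: complex and S :: "complex \<Rightarrow> complex"
  assumes c: "c \<noteq> 0"
    and per: "S (\<zeta> + of_real (2 * pi) * \<i>) = S \<zeta> + of_real (2 * pi) * \<i> / c"
begin

lemma per_nat: "S (\<zeta> + of_nat n * (of_real (2 * pi) * \<i>)) = S \<zeta> + of_nat n * (of_real (2 * pi) * \<i>) / c"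
proof (induction n)
  case (Suc n)
  have "S (\<zeta> + of_nat (Suc n) * (of_real (2 * pi) * \<i>)) = S ((\<zeta> + of_nat n * (of_real (2 * pi) * \<i>)) + of_real (2 * pi) * \<i>)"
    by (simp add: algebra_simps)
  then show ?case by (simp only: per Suc) (simp add: algebra_simps add_divide_distrib)
qed simp

lemma per_int: "S (\<zeta> + of_int n * (of_real (2 * pi) * \<i>)) = S \<zeta> + of_int n * (of_real (2 * pi) * \<i>) / c"
proof (cases "n \<ge> 0")
  case True
  then show ?thesis using per_nat[of \<zeta> "nat n"] by simp
next
  case False
  then show ?thesis
    using per_nat[of "\<zeta> + of_int n * (of_real (2 * pi) * \<i>)" "nat (- n)"] by (simp add: algebra_simps)
qed

lemma exp_conjugate_exp: "exp_conjugate c S (exp \<zeta>) = exp (c * S \<zeta>)"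
proof -
  have "exp (Ln (exp \<zeta>)) = exp \<zeta>" by simp
  then obtain n :: int where "Ln (exp \<zeta>) = \<zeta> + (of_int (2 * n) * pi) * \<i>" using exp_eq by blast
  then have n: "Ln (exp \<zeta>) = \<zeta> + of_int n * (of_real (2 * pi) * \<i>)" by (simp add: algebra_simps)
  have "exp (c * S (Ln (exp \<zeta>))) = exp (c * S \<zeta> + (of_int (2 * n) * pi) * \<i>)"
    using c by (simp only: n per_int) (simp add: algebra_simps)
  also have "\<dots> = exp (c * S \<zeta>)" using exp_eq by blast
  finally show ?thesis by (simp add: exp_conjugate_def)
qed

lemma inj_exp_conjugate:
  assumes "inj S"
  shows "inj (exp_conjugate c S)"
proof (rule injI)
  fix x y assume eq: "exp_conjugate c S x = exp_conjugate c S y"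
  show "x = y"
  proof (cases "x = 0 \<or> y = 0")
    case True
    then show ?thesis using eq by (auto simp: exp_conjugate_def split: if_splits)
  next
    case False
    then have xy: "exp (Ln x) = x" "exp (Ln y) = y" by auto
    have "exp (c * S (Ln x)) = exp (c * S (Ln y))" using eq False by (simp add: exp_conjugate_def)
    then obtain n :: int where n: "c * S (Ln x) = c * S (Ln y) + (of_int (2 * n) * pi) * \<i>" using exp_eq by blast
    then have "S (Ln x) = (c * S (Ln y) + (of_int (2 * n) * pi) * \<i>) / c" using c by (metis nonzero_mult_div_cancel_left)
    also have "\<dots> = S (Ln y + of_int n * (of_real (2 * pi) * \<i>))"
      using c by (simp only: per_int) (simp add: field_simps)
    finally have "Ln x = Ln y + of_int n * (of_real (2 * pi) * \<i>)" using assms by (simp add: inj_eq)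
    then have "Ln x = Ln y + (of_int (2 * n) * pi) * \<i>" by (simp add: algebra_simps)
    then have "exp (Ln x) = exp (Ln y)" using exp_eq by blast
    then show ?thesis using xy by simp
  qed
qed

text \<open>
The principal logarithm is discontinuous along the negative axis. Recentring it at \<open>z0\<close> gives a holomorphic
branch near any point, and by periodicity the choice of branch does not change the map.
\<close>

lemma local_log:
  assumes z0: "z0 \<noteq> 0" and l_def: "l = (\<lambda>z. Ln z0 + Ln (z / z0))"
  shows "l holomorphic_on ball z0 (cmod z0)"
    and "\<And>z. z \<in> ball z0 (cmod z0) \<Longrightarrow> exp (l z) = z"
    and "\<And>z. z \<in> ball z0 (cmod z0) \<Longrightarrow> exp_conjugate c S z = exp (c * S (l z))"
    and "(l has_field_derivative 1 / z0) (at z0)" and "l z0 = Ln z0"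
proof -
  have pos: "z / z0 \<notin> \<real>\<^sub>\<le>\<^sub>0" if "z \<in> ball z0 (cmod z0)" for z
  proof -
    have "z / z0 - 1 = (z - z0) / z0" using z0 by (simp add: field_simps)
    then have "cmod (z / z0 - 1) < 1" using that z0 by (simp add: norm_divide dist_norm norm_minus_commute)
    moreover have "\<bar>Re (z / z0 - 1)\<bar> \<le> cmod (z / z0 - 1)" by (rule abs_Re_le_cmod)
    ultimately have "Re (z / z0) > 0" by simp
    then show ?thesis by (auto simp: complex_nonpos_Reals_iff)
  qed
  show "l holomorphic_on ball z0 (cmod z0)"
    unfolding l_def using pos z0 by (intro holomorphic_intros) auto
  show el: "exp (l z) = z" if "z \<in> ball z0 (cmod z0)" for z
    using z0 pos[OF that] unfolding l_def exp_add by (subst exp_Ln; (subst exp_Ln)?) auto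
  show "exp_conjugate c S z = exp (c * S (l z))" if "z \<in> ball z0 (cmod z0)" for z
    using exp_conjugate_exp[of "l z"] el[OF that] by simp
  show "(l has_field_derivative 1 / z0) (at z0)"
    unfolding l_def using z0 by (auto intro!: derivative_eq_intros)
  show "l z0 = Ln z0" using z0 by (simp add: l_def)
qed

lemma exp_conjugate_lipschitz_near:
  assumes z0: "z0 \<noteq> 0" and S: "L-lipschitz_on UNIV S"
  shows "\<exists>u>0. \<exists>B. B-lipschitz_on (cball z0 u) (exp_conjugate c S)"
proof -
  define l where "l = (\<lambda>z. Ln z0 + Ln (z / z0))"
  note ll = local_log[OF z0 l_def]
  define u where "u = cmod z0 / 2"
  have u: "u > 0" "cball z0 u \<subseteq> ball z0 (cmod z0)"
    using z0 by (auto simp: u_def cball_subset_ball_iff)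
  obtain L1 where L1: "L1-lipschitz_on (cball z0 u) l"
    using holomorphic_lipschitz_on_compact[OF ll(1) _ _ _ u(2)] by auto
  have "(L * L1)-lipschitz_on (cball z0 u) (\<lambda>z. S (l z))"
    by (rule lipschitz_on_compose2[OF L1 lipschitz_on_subset[OF S]]) auto
  then have L2: "(cmod c * (L * L1))-lipschitz_on (cball z0 u) (\<lambda>z. c * S (l z))"
    by (auto simp: lipschitz_on_def dist_norm norm_mult mult.assoc mult_left_mono simp flip: right_diff_distrib)
  have "compact ((\<lambda>z. c * S (l z)) ` cball z0 u)"
    by (intro compact_continuous_image lipschitz_on_continuous_on[OF L2]) auto
  then obtain r where r: "(\<lambda>z. c * S (l z)) ` cball z0 u \<subseteq> cball 0 r"
    by (meson bounded_subset_ballD ball_subset_cball order_trans compact_imp_bounded)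
  obtain L3 where L3: "L3-lipschitz_on (cball 0 r) (exp :: complex \<Rightarrow> complex)"
    using holomorphic_lipschitz_on_compact[of exp UNIV "cball 0 r"] by (auto intro: holomorphic_on_exp)
  have "(L3 * (cmod c * (L * L1)))-lipschitz_on (cball z0 u) (\<lambda>z. exp (c * S (l z)))"
    by (rule lipschitz_on_compose2[OF L2 lipschitz_on_subset[OF L3 r]])
  then have "(L3 * (cmod c * (L * L1)))-lipschitz_on (cball z0 u) (exp_conjugate c S)"
    by (rule lipschitz_on_transform) (use ll(3) u(2) in auto)
  with u(1) show ?thesis by blast
qed

lemma exp_conjugate_has_derivative:
  assumes z: "z \<noteq> 0" and D: "(S has_derivative D) (at (Ln z))"
  shows "(exp_conjugate c S has_derivative (\<lambda>h. exp_conjugate c S z * (c * D (h / z)))) (at z)"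
proof -
  define l where "l = (\<lambda>\<xi>. Ln z + Ln (\<xi> / z))"
  note ll = local_log[OF z l_def]
  have "(*) (1 / z) = (\<lambda>h. h / z)" by (auto simp: fun_eq_iff)
  then have dl: "(l has_derivative (\<lambda>h. h / z)) (at z)"
    using ll(4) by (simp only: has_field_derivative_def)
  have "((\<lambda>\<xi>. S (l \<xi>)) has_derivative (\<lambda>h. D (h / z))) (at z)"
    by (rule has_derivative_compose[OF dl]) (simp only: ll(5) D)
  then have "((\<lambda>\<xi>. c * S (l \<xi>)) has_derivative (\<lambda>h. c * D (h / z))) (at z)"
    by (rule has_derivative_mult_right)
  then have "((\<lambda>\<xi>. exp (c * S (l \<xi>))) has_derivative (\<lambda>h. exp (c * S (l z)) * (c * D (h / z)))) (at z)"
    by (rule has_derivative_compose[OF _ DERIV_exp[unfolded has_field_derivative_def]])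
  then have "((\<lambda>\<xi>. exp (c * S (l \<xi>))) has_derivative (\<lambda>h. exp_conjugate c S z * (c * D (h / z)))) (at z)"
    using ll(3)[of z] z by (simp only: centre_in_ball zero_less_norm_iff simp_thms)
  then show ?thesis
    by (rule has_derivative_transform_within_open[where s="ball z (cmod z)"]) (use z ll(3) in auto)
qed

end

section \<open>Local degree of an injective map of the plane\<close>

text \<open>
The loop \<open>F (z + r e) - F z\<close>, with \<open>e\<close> running through the unit circle, avoids 0 for every centre and
radius, by injectivity. So it is homotopic in the punctured plane to the loop with centre 0 and a small
radius, where \<open>exp (g z)\<close> can be deformed to 1.
\<close>

lemma sense_preserving_injI:
  fixes F :: "complex \<Rightarrow> complex"
  assumes cont: "continuous_on UNIV F" and inj: "inj F"
    and F: "\<And>z. z \<in> ball 0 \<rho> \<Longrightarrow> F z = z * exp (g z)" and g: "continuous_on (ball 0 \<rho>) g" and \<rho>: "\<rho> > 0"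
  shows "sense_preserving_on G F"
  unfolding sense_preserving_on_def
proof (intro allI impI, elim conjE)
  fix z :: complex and r :: real assume r: "0 < r"
  define s where "s = \<rho> / 2"
  have s: "0 < s" "s < \<rho>" using \<rho> by (auto simp: s_def)
  have F0: "F 0 = 0" using F[of 0] \<rho> by simp
  define E where "E = (\<lambda>t::real. exp (2 * of_real pi * \<i> * of_real t))"
  have cp: "circlepath x q = (\<lambda>t. x + of_real q * E t)" for x q
    by (simp add: circlepath E_def fun_eq_iff)
  have contE: "continuous_on A E" for A unfolding E_def by (intro continuous_intros)
  have E1: "E 0 = 1" "E 1 = 1" by (simp_all add: E_def)
  have nE: "cmod (E t) = 1" for t by (simp add: E_def)
  have "winding_number (F \<circ> circlepath z r) (F z) = winding_number (\<lambda>t. F (z + of_real r * E t) - F z) 0"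
    by (subst winding_number_offset) (simp add: cp)
  also have "\<dots> = winding_number (\<lambda>t. F (of_real s * E t)) 0"
  proof (rule winding_number_homotopic_loops, unfold homotopic_loops, intro exI conjI ballI)
    define h where "h = (\<lambda>(\<tau>::real,t). F (of_real (1 - \<tau>) * z + of_real ((1 - \<tau>) * r + \<tau> * s) * E t) - F (of_real (1 - \<tau>) * z))"
    show "continuous_on ({0..1} \<times> {0..1}) h"
      unfolding h_def case_prod_unfold E_def
      by (intro continuous_intros continuous_on_compose2[OF cont]) auto
    show "h \<in> ({0..1} \<times> {0..1}) \<rightarrow> - {0}"
    proof -
      have False if t: "0 \<le> \<tau>" "\<tau> \<le> 1" and 0: "h (\<tau>, t) = 0" for \<tau> t
      proof -
        have "of_real ((1 - \<tau>) * r + \<tau> * s) * E t = 0"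
          using inj 0 by (simp add: h_def inj_eq)
        then have "(1 - \<tau>) * r + \<tau> * s = 0" using nE[of t] by (metis mult_eq_0_iff norm_zero of_real_eq_0_iff zero_neq_one)
        moreover have "(1 - \<tau>) * r + \<tau> * s > 0"
        proof (cases "\<tau> = 0")
          case False
          then show ?thesis using t r s by (intro add_nonneg_pos mult_nonneg_nonneg mult_pos_pos) auto
        qed (use r in simp)
        ultimately show False by simp
      qed
      then show ?thesis by auto
    qed
  qed (auto simp: E1 pathfinish_def pathstart_def F0)
  also have "\<dots> = winding_number (\<lambda>t. of_real s * E t) 0"
  proof (rule winding_number_homotopic_loops, unfold homotopic_loops, intro exI conjI ballI)
    define h where "h = (\<lambda>(\<tau>::real,t). of_real s * E t * exp (of_real (1 - \<tau>) * g (of_real s * E t)))"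
    have inb: "of_real s * E t \<in> ball 0 \<rho>" for t using s nE[of t] by (simp add: norm_mult)
    show "continuous_on ({0..1} \<times> {0..1}) h"
      unfolding h_def case_prod_unfold
      by (intro continuous_intros continuous_on_compose2[OF g] continuous_on_compose2[OF contE[of UNIV]])
        (use inb in auto)
    show "h \<in> ({0..1} \<times> {0..1}) \<rightarrow> - {0}"
      using s by (auto simp: h_def E_def)
    show "h (0, t) = F (of_real s * E t)" for t using F[OF inb] by (simp add: h_def)
    show "h (1, t) = of_real s * E t" for t by (simp add: h_def)
    show "pathfinish (h \<circ> Pair \<tau>) = pathstart (h \<circ> Pair \<tau>)" for \<tau>
      by (simp add: h_def pathfinish_def pathstart_def E1)
  qed
  also have "\<dots> = 1" using winding_number_circlepath_centre[OF s(1), of 0] by (simp add: cp)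
  finally show "winding_number (F \<circ> circlepath z r) (F z) = 1" .
qed

section \<open>Quasiconformality of the glued map\<close>

lemma negligible_UNIV_times:
  fixes E :: "real set"
  assumes "negligible E"
  shows "negligible ((UNIV :: real set) \<times> E)"
proof -
  obtain E' where E': "E' \<in> null_sets lborel" "E \<subseteq> E'"
    using assms by (auto simp: negligible_iff_null_sets null_sets_completion_iff2)
  then have "emeasure (lborel \<Otimes>\<^sub>M lborel) ((UNIV :: real set) \<times> E') = 0"
    by (subst lborel.emeasure_pair_measure_Times) auto
  then have "(UNIV :: real set) \<times> E' \<in> null_sets (lborel \<Otimes>\<^sub>M lborel)"
    using E' by (intro null_setsI) auto
  then have "negligible ((UNIV :: real set) \<times> E')"
    by (simp add: lborel_prod negligible_iff_null_sets null_sets_completionI)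
  then show ?thesis by (rule negligible_subset) (use E' in auto)
qed

lemma negligible_exp_horizontal_lines:
  assumes "negligible E"
  shows "negligible (exp ` {\<zeta>. Im \<zeta> \<in> E})"
proof -
  define e :: "real \<times> real \<Rightarrow> complex" where "e = (\<lambda>p. exp (of_real (fst p) + \<i> * of_real (snd p)))"
  have "e differentiable (at p)" for p
  proof -
    have "((\<lambda>p::real\<times>real. complex_of_real (fst p) + \<i> * of_real (snd p)) has_derivative (\<lambda>h. of_real (fst h) + \<i> * of_real (snd h))) (at p)"
      by (auto intro!: derivative_eq_intros)
    from has_derivative_compose[OF this DERIV_exp[unfolded has_field_derivative_def]]
    show ?thesis unfolding e_def differentiable_def by blast
  qed
  then have "negligible (e ` (UNIV \<times> E))"
    by (intro negligible_differentiable_image_negligible negligible_UNIV_times assms)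
       (auto simp: differentiable_on_def intro: differentiable_at_withinI)
  moreover have "exp ` {\<zeta>. Im \<zeta> \<in> E} \<subseteq> e ` (UNIV \<times> E)"
  proof
    fix z assume "z \<in> exp ` {\<zeta>. Im \<zeta> \<in> E}"
    then obtain \<zeta> where "Im \<zeta> \<in> E" "z = exp \<zeta>" by auto
    then have "(Re \<zeta>, Im \<zeta>) \<in> UNIV \<times> E" "z = e (Re \<zeta>, Im \<zeta>)" by (auto simp: e_def simp flip: complex_eq)
    then show "z \<in> e ` (UNIV \<times> E)" by blast
  qed
  ultimately show ?thesis by (rule negligible_subset)
qed

text \<open>
The map \<open>M\<close> is the logarithmic form of \<open>z * exp (g z)\<close>, extended to the imaginary axis. The condition
on \<open>Re c\<close> makes the outer part of \<open>F\<close> grow with \<open>\<bar>z\<bar>\<close>.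
\<close>

locale boundary_gluing = nearly_linear M w R for M w R +
  fixes c :: complex and g :: "complex \<Rightarrow> complex"
  assumes Re_c: "Re c > 0"
    and g: "g holomorphic_on ball 0 1"
    and M_left: "Re \<zeta> < 0 \<Longrightarrow> M \<zeta> = (\<zeta> + g (exp \<zeta>)) / c"
    and M_per: "Re \<zeta> \<le> 0 \<Longrightarrow> M (\<zeta> + of_real (2 * pi) * \<i>) = M \<zeta> + of_real (2 * pi) * \<i> / c"
begin

lemma c_nz: "c \<noteq> 0" using Re_c by auto

sublocale periodic_map c "shift_extension M"
proof
  show "c \<noteq> 0" by (rule c_nz)
  fix \<zeta>
  have "half_plane_proj (\<zeta> + of_real (2 * pi) * \<i>) = half_plane_proj \<zeta> + of_real (2 * pi) * \<i>"
    by (simp add: half_plane_proj_def complex_eq_iff)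
  then show "shift_extension M (\<zeta> + of_real (2 * pi) * \<i>) = shift_extension M \<zeta> + of_real (2 * pi) * \<i> / c"
    using M_per[OF Re_half_plane_proj, of \<zeta>] by (simp add: shift_extension_def)
qed

abbreviation "F \<equiv> exp_conjugate c (shift_extension M)"

lemma F_disc: "F z = z * exp (g z)" if "z \<in> ball 0 1"
proof (cases "z = 0")
  case False
  then have Re: "Re (Ln z) < 0" using that by (simp add: Re_Ln ln_less_zero_iff)
  then have "half_plane_proj (Ln z) = Ln z" by (simp add: half_plane_proj_def complex_eq_iff)
  then have "c * shift_extension M (Ln z) = Ln z + g z"
    using Re False c_nz by (simp add: shift_extension_def M_left)
  then show ?thesis using False by (simp add: exp_conjugate_def exp_add)
qed (simp add: exp_conjugate_def)

lemma F_holomorphic: "F holomorphic_on ball 0 1"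
proof -
  have "(\<lambda>z. z * exp (g z)) holomorphic_on ball 0 1" by (intro holomorphic_intros g)
  then show ?thesis using F_disc holomorphic_transform by (metis (no_types, lifting))
qed

text \<open>
Near 0 the map is holomorphic, and elsewhere it is a Lipschitz map conjugated by local
logarithms.
\<close>

lemma F_lipschitz:
  assumes "compact K"
  shows "\<exists>L. L-lipschitz_on K F"
proof -
  have near: "\<exists>u>0. \<exists>L. L-lipschitz_on (cball z u) F" for z
  proof (cases "z = 0")
    case True
    have "\<exists>L. L-lipschitz_on (cball 0 (1/2)) F"
      by (rule holomorphic_lipschitz_on_compact[OF F_holomorphic]) auto
    then show ?thesis using True by (intro exI[of _ "1/2"]) auto
  qed (rule exp_conjugate_lipschitz_near[OF _ shift_extension_lipschitz])
  have "local_lipschitz {0::real} K (\<lambda>_. F)"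
    unfolding local_lipschitz_def
  proof (intro ballI)
    fix z t assume "z \<in> K" "t \<in> {0::real}"
    obtain u L where "u > 0" "L-lipschitz_on (cball z u) F" using near[of z] by blast
    then show "\<exists>u>0. \<exists>L. \<forall>t\<in>cball t u \<inter> {0}. L-lipschitz_on (cball z u \<inter> K) F"
      by (meson inf_le1 lipschitz_on_subset)
  qed
  then obtain L where "\<And>t. t \<in> {0::real} \<Longrightarrow> L-lipschitz_on K F"
    by (rule local_lipschitz_compact_implies_lipschitz[OF _ assms, where T="{0::real}"]) auto
  then show ?thesis by auto
qed

lemma F_continuous: "continuous_on UNIV F"
proof -
  have "continuous_on (ball z 1) F" for z
    using F_lipschitz[of "cball z 1"] by (meson ball_subset_cball compact_cball continuous_on_subset lipschitz_on_continuous_on)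
  then show ?thesis
    by (simp add: continuous_on_eq_continuous_at) (meson centre_in_ball continuous_on_eq_continuous_at open_ball zero_less_one)
qed

lemma inj_F: "inj F"
  by (rule inj_exp_conjugate[OF inj_shift_extension])

text \<open>
Along a ray outside the disc, \<open>F\<close> is its value on the unit circle times \<open>r\<^sup>c\<close>, and on the circle
\<open>F\<close> is bounded away from 0.
\<close>

lemma F_growth: "\<exists>m>0. \<forall>z. 1 \<le> cmod z \<longrightarrow> m * exp (Re c * ln (cmod z)) \<le> cmod (F z)"
proof -
  have "\<exists>x\<in>sphere 0 1. \<forall>y\<in>sphere 0 1. cmod (F x) \<le> cmod (F y)"
    by (intro continuous_attains_inf continuous_on_norm continuous_on_subset[OF F_continuous]) auto
  then obtain x where x: "x \<in> sphere 0 1" "\<And>y. y \<in> sphere 0 1 \<Longrightarrow> cmod (F x) \<le> cmod (F y)" by blast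
  have "F x \<noteq> 0" using x(1) by (auto simp: exp_conjugate_def)
  moreover have "cmod (F x) * exp (Re c * ln (cmod z)) \<le> cmod (F z)" if z: "1 \<le> cmod z" for z
  proof -
    define \<zeta> where "\<zeta> = Ln z"
    have nz: "z \<noteq> 0" using z by auto
    have Re: "Re \<zeta> = ln (cmod z)" "Re \<zeta> \<ge> 0" using z nz by (auto simp: \<zeta>_def)
    have "shift_extension M \<zeta> = shift_extension M (\<i> * of_real (Im \<zeta>)) + of_real (Re \<zeta>)"
      using Re(2) by (simp add: shift_extension_def half_plane_proj_def)
    then have "c * shift_extension M \<zeta> = c * shift_extension M (\<i> * of_real (Im \<zeta>)) + c * of_real (Re \<zeta>)"
      by (simp add: algebra_simps)
    moreover have "F z = exp (c * shift_extension M \<zeta>)" using nz by (simp add: exp_conjugate_def \<zeta>_def)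
    ultimately have "F z = F (exp (\<i> * of_real (Im \<zeta>))) * exp (c * of_real (Re \<zeta>))"
      by (simp add: exp_conjugate_exp exp_add)
    then have "cmod (F z) = cmod (F (exp (\<i> * of_real (Im \<zeta>)))) * exp (Re c * ln (cmod z))"
      by (simp add: norm_mult Re)
    then show ?thesis using x(2)[of "exp (\<i> * of_real (Im \<zeta>))"] by simp
  qed
  ultimately show ?thesis by (intro exI[of _ "cmod (F x)"]) auto
qed

text \<open>
The range is open by invariance of domain and closed because \<open>F\<close> is proper.
\<close>

lemma range_F: "range F = UNIV"
proof -
  obtain m where m: "m > 0" "\<And>z. 1 \<le> cmod z \<Longrightarrow> m * exp (Re c * ln (cmod z)) \<le> cmod (F z)"
    using F_growth by blast
  have "open (range F)" by (intro invariance_of_domain F_continuous inj_F) auto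
  moreover have "closed (range F)"
    unfolding closed_sequential_limits
  proof (intro allI impI, elim conjE)
    fix y l assume y: "\<forall>n. y n \<in> range F" and l: "y \<longlonglongrightarrow> l"
    obtain B where B: "B > 0" "\<And>n. cmod (y n) \<le> B"
      using convergent_imp_Bseq[OF convergentI[OF l]] by (auto simp: Bseq_def)
    define \<rho> where "\<rho> = max 1 (exp (ln (B / m) / Re c))"
    have in_ball: "z \<in> cball 0 \<rho>" if z: "cmod (F z) \<le> B" for z
    proof (cases "1 \<le> cmod z")
      case True
      have "exp (Re c * ln (cmod z)) \<le> B / m" using m(2)[OF True] z m(1) by (simp add: field_simps)
      then have "Re c * ln (cmod z) \<le> ln (B / m)" using B m by (subst ln_ge_iff) auto
      then have "ln (cmod z) \<le> ln (B / m) / Re c" using Re_c by (simp add: field_simps)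
      then have "cmod z \<le> exp (ln (B / m) / Re c)" using True by (metis exp_le_cancel_iff exp_ln less_le_trans zero_less_one)
      then show ?thesis by (simp add: \<rho>_def)
    qed (simp add: \<rho>_def)
    have "y n \<in> F ` cball 0 \<rho>" for n
    proof -
      obtain x where "y n = F x" using y by blast
      then show ?thesis using in_ball[of x] B(2)[of n] by simp
    qed
    moreover have "closed (F ` cball 0 \<rho>)"
      by (intro compact_imp_closed compact_continuous_image continuous_on_subset[OF F_continuous]) auto
    ultimately have "l \<in> F ` cball 0 \<rho>" using closed_sequentially[of "F ` cball 0 \<rho>" y l] l by blast
    then show "l \<in> range F" by blast
  qed
  ultimately show ?thesis using clopen[of "range F"] by auto
qed

text \<open>
With \<open>v = 1 / z\<close>, the derivative is \<open>F z * c\<close> times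
\<open>h \<mapsto> ((1 + Q) * (h * v) + (1 - Q) * cnj (h * v)) / 2\<close>, so the \<open>z\<close>- and \<open>zbar\<close>-derivatives have the ratio of
\<open>1 + Q\<close> to \<open>1 - Q\<close> in modulus.
\<close>

lemma F_derivative_outside:
  assumes z: "cmod z > 1" and diff: "(\<lambda>\<theta>. M (\<i> * of_real \<theta>)) differentiable (at (Im (Ln z)))"
  shows "\<exists>D Q. (F has_derivative D) (at z) \<and> cmod (Q - of_real w) \<le> R \<and>
    cmod (D 1 + \<i> * D \<i>) * cmod (1 + Q) = cmod (D 1 - \<i> * D \<i>) * cmod (1 - Q)"
proof -
  have nz: "z \<noteq> 0" using z by auto
  have "Re (Ln z) > 0" using z nz by simp
  then obtain Q where Q: "cmod (Q - of_real w) \<le> R"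
    and d: "(shift_extension M has_derivative (\<lambda>h. of_real (Re h) + \<i> * Q * of_real (Im h))) (at (Ln z))"
    using shift_extension_has_derivative[OF _ diff] by blast
  define D where "D = (\<lambda>h. F z * (c * (of_real (Re (h / z)) + \<i> * Q * of_real (Im (h / z)))))"
  have D: "(F has_derivative D) (at z)" unfolding D_def by (rule exp_conjugate_has_derivative[OF nz d])
  define v where "v = 1 / z"
  have A: "of_real (Re h) + \<i> * Q * of_real (Im h) = ((1 + Q) * h + (1 - Q) * cnj h) / 2" for h
    by (subst (2) complex_eq, subst (3) complex_eq) (simp add: complex_cnj_add field_simps)
  have D1: "D 1 = F z * c * ((1 + Q) * v + (1 - Q) * cnj v) / 2"
    unfolding D_def A by (simp add: v_def mult.assoc)
  have Di: "D \<i> = F z * c * ((1 + Q) * (\<i> * v) + (1 - Q) * cnj (\<i> * v)) / 2"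
    unfolding D_def A by (simp add: v_def mult.assoc)
  have "D 1 + \<i> * D \<i> = F z * c * ((1 - Q) * cnj v)"
    unfolding D1 Di by (simp add: field_simps)
  moreover have "D 1 - \<i> * D \<i> = F z * c * ((1 + Q) * v)"
    unfolding D1 Di by (simp add: field_simps)
  ultimately have "cmod (D 1 + \<i> * D \<i>) * cmod (1 + Q) = cmod (D 1 - \<i> * D \<i>) * cmod (1 - Q)"
    by (simp add: norm_mult)
  with D Q show ?thesis by blast
qed

text \<open>
The exceptional points are those on the unit circle and those on the rays over the angles where the boundary curve
is not differentiable; in logarithmic coordinates the rays form a product with a null set.
\<close>

lemma F_ae_derivative:
  "AE z in lborel. \<exists>D. (F has_derivative D) (at z) \<and>
     (D 1 + \<i> * D \<i> = 0 \<or> (\<exists>Q. cmod (Q - of_real w) \<le> R \<and>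
        cmod (D 1 + \<i> * D \<i>) * cmod (1 + Q) = cmod (D 1 - \<i> * D \<i>) * cmod (1 - Q)))"
proof -
  define N where "N = (\<lambda>\<theta>. M (\<i> * of_real \<theta>))"
  have N: "N \<theta> = shift_extension M (\<i> * of_real \<theta>)" for \<theta>
  proof -
    have "half_plane_proj (\<i> * of_real \<theta>) = \<i> * of_real \<theta>" by (simp add: half_plane_proj_def complex_eq_iff)
    then show ?thesis by (simp add: N_def shift_extension_def)
  qed
  have "(R + w + 1)-lipschitz_on UNIV N"
  proof (rule lipschitz_onI)
    fix x y :: real
    have "\<i> * of_real x - \<i> * of_real y = \<i> * complex_of_real (x - y)" by (simp add: algebra_simps)
    then have "dist (\<i> * complex_of_real x) (\<i> * complex_of_real y) = dist x y"
      by (simp only: dist_norm norm_mult norm_of_real norm_ii mult_1_left real_norm_def)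
    then show "dist (N x) (N y) \<le> (R + w + 1) * dist x y"
      using lipschitz_onD[OF shift_extension_lipschitz, of "\<i> * of_real x" "\<i> * of_real y"] by (simp add: N)
  qed (use R w in simp)
  then have "negligible {\<theta>. \<not> N differentiable (at \<theta>)}" by (rule lipschitz_complex_ae_differentiable)
  then have "negligible (exp ` {\<zeta>. Im \<zeta> \<in> {\<theta>. \<not> N differentiable (at \<theta>)}} \<union> sphere 0 1)"
    by (intro negligible_Un negligible_exp_horizontal_lines negligible_sphere)
  then have "AE z in lebesgue. z \<notin> exp ` {\<zeta>. Im \<zeta> \<in> {\<theta>. \<not> N differentiable (at \<theta>)}} \<union> sphere 0 1"
    unfolding negligible_iff_null_sets by (rule AE_not_in)
  then have "AE z in lborel. z \<notin> exp ` {\<zeta>. Im \<zeta> \<in> {\<theta>. \<not> N differentiable (at \<theta>)}} \<union> sphere 0 1"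
    by (simp only: AE_completion_iff)
  then show ?thesis
  proof (rule AE_mp, intro AE_I2 impI)
    fix z assume z: "z \<notin> exp ` {\<zeta>. Im \<zeta> \<in> {\<theta>. \<not> N differentiable (at \<theta>)}} \<union> sphere 0 1"
    then consider "cmod z < 1" | "cmod z > 1" by (force simp: sphere_def)
    then show "\<exists>D. (F has_derivative D) (at z) \<and>
     (D 1 + \<i> * D \<i> = 0 \<or> (\<exists>Q. cmod (Q - of_real w) \<le> R \<and>
        cmod (D 1 + \<i> * D \<i>) * cmod (1 + Q) = cmod (D 1 - \<i> * D \<i>) * cmod (1 - Q)))"
    proof cases
      case 1
      then have "(F has_field_derivative deriv F z) (at z)"
        by (intro holomorphic_derivI[OF F_holomorphic]) auto
      then show ?thesis unfolding has_field_derivative_def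
        by (intro exI[of _ "(*) (deriv F z)"]) (simp add: mult.left_commute[of \<i>])
    next
      case 2
      then have "exp (Ln z) = z" by (intro exp_Ln) auto
      then have "N differentiable (at (Im (Ln z)))" using z by (metis (mono_tags, lifting) UnCI imageI mem_Collect_eq)
      then show ?thesis using F_derivative_outside[OF 2] unfolding N_def by blast
    qed
  qed
qed

lemma F_quasiconformal:
  assumes k: "0 \<le> k" "k < 1"
    and dil: "\<And>Q. cmod (Q - of_real w) \<le> R \<Longrightarrow> cmod (1 - Q) \<le> k * cmod (1 + Q)"
  shows "quasiconformal_on k UNIV F"
proof -
  have diff: "AE z in lborel. F differentiable (at z)"
    using F_ae_derivative by (rule AE_mp) (auto simp: differentiable_def)
  have dom: "AE z in lborel. cmod ((pointwise_deriv F 1 z + \<i> * pointwise_deriv F \<i> z) / 2)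
      \<le> k * cmod ((pointwise_deriv F 1 z - \<i> * pointwise_deriv F \<i> z) / 2)"
    using F_ae_derivative
  proof (rule AE_mp, intro AE_I2 impI, elim exE conjE)
    fix z D assume D: "(F has_derivative D) (at z)"
      and alt: "D 1 + \<i> * D \<i> = 0 \<or> (\<exists>Q. cmod (Q - of_real w) \<le> R \<and>
        cmod (D 1 + \<i> * D \<i>) * cmod (1 + Q) = cmod (D 1 - \<i> * D \<i>) * cmod (1 - Q))"
    from alt have "cmod (D 1 + \<i> * D \<i>) \<le> k * cmod (D 1 - \<i> * D \<i>)"
    proof (elim disjE exE conjE)
      fix Q assume Q: "cmod (Q - of_real w) \<le> R"
        and eq: "cmod (D 1 + \<i> * D \<i>) * cmod (1 + Q) = cmod (D 1 - \<i> * D \<i>) * cmod (1 - Q)"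
      have nz: "cmod (1 + Q) > 0"
      proof (rule ccontr)
        assume "\<not> cmod (1 + Q) > 0"
        then have "1 + Q = 0" by simp
        with dil[OF Q] have "1 - Q = 0" by simp
        with \<open>1 + Q = 0\<close> have "(1 + Q) + (1 - Q) = 0" by simp
        then show False by simp
      qed
      have "cmod (D 1 - \<i> * D \<i>) * cmod (1 - Q) \<le> cmod (D 1 - \<i> * D \<i>) * (k * cmod (1 + Q))"
        by (intro mult_left_mono dil Q) auto
      then have "cmod (D 1 + \<i> * D \<i>) * cmod (1 + Q) \<le> (k * cmod (D 1 - \<i> * D \<i>)) * cmod (1 + Q)"
        by (subst eq) (simp only: mult_ac)
      then show ?thesis using nz by simp
    qed (use k in simp)
    then show "cmod ((pointwise_deriv F 1 z + \<i> * pointwise_deriv F \<i> z) / 2)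
      \<le> k * cmod ((pointwise_deriv F 1 z - \<i> * pointwise_deriv F \<i> z) / 2)"
      by (simp add: pointwise_deriv_eq[OF D] norm_divide)
  qed
  have "\<exists>H. homeomorphism UNIV (range F) F H"
    using invariance_of_domain_homeomorphism[OF open_UNIV F_continuous _ inj_F] by auto
  moreover have "sense_preserving_on UNIV F"
    by (rule sense_preserving_injI[OF F_continuous inj_F F_disc holomorphic_on_imp_continuous_on[OF g]]) auto
  moreover have "AE z in lebesgue. z \<in> UNIV \<longrightarrow> cmod ((pointwise_deriv F 1 z + \<i> * pointwise_deriv F \<i> z) / 2)
      \<le> k * cmod ((pointwise_deriv F 1 z - \<i> * pointwise_deriv F \<i> z) / 2)"
    using dom by (simp add: AE_completion_iff)
  moreover have "has_dist_deriv_z F (\<lambda>z. (pointwise_deriv F 1 z - \<i> * pointwise_deriv F \<i> z) / 2) UNIV"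
    "has_dist_deriv_zbar F (\<lambda>z. (pointwise_deriv F 1 z + \<i> * pointwise_deriv F \<i> z) / 2) UNIV"
    by (rule has_dist_deriv_pointwise[OF _ F_continuous diff], rule F_lipschitz, assumption)+
  ultimately show ?thesis
    unfolding quasiconformal_on_def using k by (intro conjI) (simp_all only: open_UNIV connected_UNIV UNIV_not_empty, blast+)
qed

end

section \<open>Strongly spirallike functions\<close>

text \<open>
The circle of Apollonius: after squaring and multiplying by \<open>1 - k\<^sup>2\<close> both sides are the same quadratic
inequality, since centre and radius satisfy \<open>w\<^sup>2 - R\<^sup>2 = 1\<close>.
\<close>

lemma disc_iff_apollonius:
  assumes k: "0 \<le> k" "k < 1"
  shows "cmod (q - of_real ((1 + k\<^sup>2) / (1 - k\<^sup>2))) \<le> 2 * k / (1 - k\<^sup>2) \<longleftrightarrow> cmod (1 - q) \<le> k * cmod (1 + q)"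
proof -
  define w where "w = (1 + k\<^sup>2) / (1 - k\<^sup>2)"
  define R where "R = 2 * k / (1 - k\<^sup>2)"
  have pos: "1 - k\<^sup>2 > 0" using k by (simp add: power_less_one_iff)
  then have R: "R \<ge> 0" using k by (simp add: R_def)
  have w1: "(1 - k\<^sup>2) * w = 1 + k\<^sup>2" and R1: "(1 - k\<^sup>2) * R = 2 * k"
    using pos by (auto simp: w_def R_def)
  have "((1 - k\<^sup>2) * w)\<^sup>2 - ((1 - k\<^sup>2) * R)\<^sup>2 = (1 - k\<^sup>2)\<^sup>2"
    unfolding w1 R1 by (simp add: power2_eq_square algebra_simps)
  then have "(1 - k\<^sup>2)\<^sup>2 * (w\<^sup>2 - R\<^sup>2) = (1 - k\<^sup>2)\<^sup>2 * 1"
    by (simp only: power_mult_distrib right_diff_distrib mult_1_right)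
  then have wR: "w\<^sup>2 - R\<^sup>2 = 1" using pos by simp
  have sq: "(cmod (q - of_real w))\<^sup>2 = (Re q - w)\<^sup>2 + (Im q)\<^sup>2"
    "(cmod (1 - q))\<^sup>2 = (1 - Re q)\<^sup>2 + (Im q)\<^sup>2" "(cmod (1 + q))\<^sup>2 = (1 + Re q)\<^sup>2 + (Im q)\<^sup>2"
    by (simp_all add: cmod_power2)
  have "cmod (q - of_real w) \<le> R \<longleftrightarrow> (cmod (q - of_real w))\<^sup>2 \<le> R\<^sup>2"
    using R by (simp add: abs_le_square_iff[symmetric])
  also have "\<dots> \<longleftrightarrow> (1 - k\<^sup>2) * ((cmod (q - of_real w))\<^sup>2 - R\<^sup>2) \<le> 0"
    using pos by (simp add: mult_le_0_iff)
  also have "(1 - k\<^sup>2) * ((cmod (q - of_real w))\<^sup>2 - R\<^sup>2)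
      = (1 - k\<^sup>2) * ((Re q)\<^sup>2 + (Im q)\<^sup>2) - 2 * Re q * ((1 - k\<^sup>2) * w) + (1 - k\<^sup>2) * (w\<^sup>2 - R\<^sup>2)"
    unfolding sq by (simp add: power2_eq_square algebra_simps)
  also have "\<dots> = (cmod (1 - q))\<^sup>2 - (k * cmod (1 + q))\<^sup>2"
    unfolding w1 wR power_mult_distrib sq by (simp add: power2_eq_square algebra_simps)
  also have "\<dots> \<le> 0 \<longleftrightarrow> cmod (1 - q) \<le> k * cmod (1 + q)"
    using k by (simp add: abs_le_square_iff[symmetric])
  finally show ?thesis by (simp add: w_def R_def)
qed

lemma U_set_imp_disc:
  assumes k: "0 \<le> k" "k < 1" and q: "q \<in> U_set k"
  shows "cmod (q - of_real ((1 + k\<^sup>2) / (1 - k\<^sup>2))) \<le> 2 * k / (1 - k\<^sup>2)"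
proof -
  have "q \<noteq> -1" "cmod (q - 1) / cmod (q + 1) \<le> k" using q by (auto simp: U_set_def norm_divide)
  moreover from this have "cmod (q + 1) > 0" by (simp add: add_eq_0_iff2)
  ultimately have "cmod (q - 1) \<le> k * cmod (q + 1)" by (simp add: pos_divide_le_eq)
  then show ?thesis using disc_iff_apollonius[OF k, of q] by (simp add: norm_minus_commute add.commute)
qed

text \<open>
The quotient \<open>f z / z\<close> has a removable singularity at 0 and no zeros, so it has a holomorphic logarithm
\<open>g\<close> on the disc. Logarithmic differentiation gives the last claim.
\<close>

lemma class_A_logarithm:
  assumes f: "f \<in> class_A" and nz: "\<And>z. z \<in> ball 0 1 \<Longrightarrow> z \<noteq> 0 \<Longrightarrow> f z \<noteq> 0"
  obtains g where "g holomorphic_on ball 0 1" "\<And>z. z \<in> ball 0 1 \<Longrightarrow> f z = z * exp (g z)"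
    "\<And>z. z \<in> ball 0 1 \<Longrightarrow> starlike_quotient f z = 1 + z * deriv g z"
proof -
  have hol: "f holomorphic_on ball 0 1" and f0: "f 0 = 0" "deriv f 0 = 1" using f by (auto simp: class_A_def)
  define p where "p = (\<lambda>z. if z = 0 then deriv f 0 else (f z - f 0) / (z - 0))"
  have p: "p holomorphic_on ball 0 1" unfolding p_def by (rule pole_lemma[OF hol]) simp
  have pnz: "p z \<noteq> 0" if "z \<in> ball 0 1" for z using nz[OF that] f0 by (auto simp: p_def)
  obtain g where g: "g holomorphic_on ball 0 1" "\<And>z. z \<in> ball 0 1 \<Longrightarrow> exp (g z) = p z"
    using holomorphic_logarithm_exists[OF convex_ball open_ball p pnz, of 0] by auto
  have fg: "f z = z * exp (g z)" if "z \<in> ball 0 1" for z using g(2)[OF that] f0 by (auto simp: p_def)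
  have "starlike_quotient f z = 1 + z * deriv g z" if z: "z \<in> ball 0 1" for z
  proof (cases "z = 0")
    case False
    have "((\<lambda>z. z * exp (g z)) has_field_derivative exp (g z) + z * (exp (g z) * deriv g z)) (at z)"
      using holomorphic_derivI[OF g(1) open_ball z] by (auto intro!: derivative_eq_intros)
    then have "(f has_field_derivative exp (g z) + z * (exp (g z) * deriv g z)) (at z)"
      by (rule has_field_derivative_transform_within_open[where S="ball 0 1"]) (use z fg in auto)
    then have "deriv f z = exp (g z) + z * (exp (g z) * deriv g z)" by (rule DERIV_imp_deriv)
    then show ?thesis using False fg[OF z] by (simp add: starlike_quotient_def field_simps)
  qed (simp add: starlike_quotient_def)
  with g(1) fg show ?thesis by (rule that)
qed

theorem theorem3:
  fixes \<alpha> k :: real and f :: "complex \<Rightarrow> complex"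
  assumes "\<alpha> \<in> {- pi / 2 <..< pi / 2}"
    and "k \<in> {\<bar>tan (\<alpha> / 2)\<bar> ..< 1}"
    and "f \<in> class_A"
    and "\<And>z. z \<in> ball 0 1 \<Longrightarrow> exp (\<i> * of_real \<alpha>) * starlike_quotient f z \<in> U_set k"
  shows "has_quasiconformal_extension k f"
proof -
  have k: "0 \<le> k" "k < 1" using assms(2) by (auto intro: order_trans[OF abs_ge_zero])
  define c where "c = exp (- (\<i> * of_real \<alpha>))"
  have ce: "x / c = exp (\<i> * of_real \<alpha>) * x" for x by (simp add: c_def exp_minus divide_inverse mult.commute)
  have Re_c: "Re c > 0" using assms(1) cos_gt_zero_pi[of \<alpha>] by (simp add: c_def Re_exp)
  define w where "w = (1 + k\<^sup>2) / (1 - k\<^sup>2)"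
  define R where "R = 2 * k / (1 - k\<^sup>2)"
  have pos: "1 - k\<^sup>2 > 0" using k by (simp add: power_less_one_iff)
  have R0: "0 \<le> R" using k pos by (simp add: R_def)
  have "0 < (1 - k)\<^sup>2" using k by simp
  then have "2 * k < 1 + k\<^sup>2" by (simp add: power2_eq_square algebra_simps)
  then have Rw: "R < w" using pos by (simp add: R_def w_def divide_strict_right_mono)
  have w0: "0 < w" using R0 Rw by simp
  \<comment> \<open>At a zero of f other than 0 the quotient takes the default value 0, which U_set k excludes.\<close>
  have nz: "f z \<noteq> 0" if "z \<in> ball 0 1" "z \<noteq> 0" for z
  proof
    assume "f z = 0"
    then have "0 \<in> U_set k" using assms(4)[OF that(1)] that(2) by (simp add: starlike_quotient_def)
    then show False using k by (simp add: U_set_def)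
  qed
  obtain g where glog: "g holomorphic_on ball 0 1" "\<And>z. z \<in> ball 0 1 \<Longrightarrow> f z = z * exp (g z)"
    "\<And>z. z \<in> ball 0 1 \<Longrightarrow> starlike_quotient f z = 1 + z * deriv g z"
    using class_A_logarithm[OF assms(3) nz] by metis
  have b: "cmod ((1 + z * deriv g z) / c - of_real w) \<le> R" if "z \<in> ball 0 1" for z
    using U_set_imp_disc[OF k assms(4)[OF that]] glog(3)[OF that] by (simp add: ce w_def R_def)
  have "c \<noteq> 0" using Re_c by auto
  then obtain M where M: "\<And>x y. Re x \<le> 0 \<Longrightarrow> Re y \<le> 0 \<Longrightarrow> cmod (M x - M y - of_real w * (x - y)) \<le> R * cmod (x - y)"
    "\<And>\<zeta>. Re \<zeta> < 0 \<Longrightarrow> M \<zeta> = (\<zeta> + g (exp \<zeta>)) / c"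
    "\<And>\<zeta>. Re \<zeta> \<le> 0 \<Longrightarrow> M (\<zeta> + of_real (2 * pi) * \<i>) = M \<zeta> + of_real (2 * pi) * \<i> / c"
    using half_plane_boundary_extension[OF glog(1) _ R0 b] by metis
  interpret boundary_gluing M w R c g
    by unfold_locales (use M glog(1) w0 R0 Rw Re_c in auto)
  have "quasiconformal_on k UNIV F"
    using disc_iff_apollonius[OF k] by (intro F_quasiconformal k) (simp add: w_def R_def)
  then show ?thesis
    unfolding has_quasiconformal_extension_def using range_F F_disc glog(2) by (intro exI[of _ F]) auto
qed

end
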